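(* Let $\mathcal N$ be a 1-input regular coupled cell network with $n$ cells $c_1,\dots,c_n$ and an $m$-cell ring, $1\le m\le n$. Assume that the cells are enumerated so that the adjacency matrix of $\mathcal N$ has the block form $$A=\begin{bmatrix} C_{m\times m} & 0_{m\times(n-m)}\\ B_{(n-m)\times m} & L_{(n-m)\times(n-m)}\end{bmatrix},$$ where $C$ is a cyclic permutation matrix with rows and columns indexed by the cells of the ring and $L$ is lower triangular. For $j=0,\dots,m-1$ let $\omega_j=e^{2\pi i j/m}$ and let $E_{\omega_j}$ be the eigenspace of $A$ for $\omega_j$. Let $t$ be the number of tails of $\mathcal N$ and let $c_{i_1},\dots,c_{i_t}$ be the leaf cells of the tails. Then the set $\mathcal J(V_{\mathcal N})$ of join-irreducible elements of the lattice $V_{\mathcal N}$ of synchrony subspaces of $\mathcal N$ is formed by: (i) the $1$-dimensional synchrony subspace $E_{\omega_0}$; (ii) for each proper divisor $d$ of $m$ different from $1$, the $\frac md$-dimensional synchrony subspace $E_{\omega_0}+E_{\omega_d}+E_{\omega_{2d}}+\cdots+E_{\omega_{(\frac md-1)d}}$; (iii) the $m$-dimensional synchrony subspace $E_{\omega_0}+E_{\omega_1}+\cdots+E_{\omega_{m-1}}$; (iv) for every $1\le l\le t$ and every possible subset $\{u_1,\dots,u_l\}\subseteq\{e_{i_1},\dots,e_{i_t}\}$, the $2$-dimensional synchrony subspace $E_{\omega_0}+\langle u_1+\cdots+u_l\rangle$; (v) for each Jordan chain $(\tilde u_1,\dots,\tilde u_q)$ of $A$ associated to the eigenvalue zero,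 where each $\tilde u_j=e_{k^j_1}+\cdots+e_{k^j_{p_j}}$, the $(q+1)$-dimensional synchrony subspace $E_{\omega_0}+\langle\tilde u_1,\dots,\tilde u_q\rangle$.
   Context: A 1-input regular coupled cell network is a finite connected directed graph (self-loops allowed) in which all cells (vertices) are of one type, all edges are of one type, and every cell receives exactly one edge. Its adjacency matrix $A=(a_{ij})$ has $a_{ij}$ equal to the number of edges from $c_j$ to $c_i$. Such a network is either a ring (a directed cycle, possibly a self-loop), or the coalescence of a ring with finitely many directed rooted trees whose edges point away from the root, the root of each tree being identified with a different cell of the ring. A leaf is a cell with no outgoing edge; a tail is the directed path from the root of a tree (a ring cell) to a leaf of that tree. Each cell phase space is taken to be $\mathbb R$, so the total phase space is $\mathbb R^n$. A synchrony subspace of $\mathcal N$ is a polydiagonal subspace of $\mathbb R^n$ (one defined by a set of equalities $x_c=x_d$ of cell coordinates) that is flow-invariant under all vector fields admissible by $\mathcal N$, i.e. of the form $\dot x_c=f(x_c;x_{i(c)})$ with $f$ smooth and $i(c)$ the tail of the unique edge into $c$; equivalently, a polydiagonal subspace that is left invariant by $A$. $V_{\mathcal N}$ is the set of synchrony subspaces, ordered by inclusion, with meet given by intersection and join given by sum of subspaces. The join-irreducible elements of $V_{\mathcal N}$ are the synchrony subspaces that are not the join (sum) of any other two synchrony subspaces in $V_{\mathcal N}$. $e_j$ is the vector with $j$-th entry $1$ and all other entries $0$ (the indices $k^j_1,\dots,k^j_{p_j}$ being pairwise distinct for each $j$); $\langle\cdot\rangle$ denotes linear span. A Jordan chain associated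 to zero is a sequence of at least two vectors such that $A$ sends each vector to the next one and sends the last one, which is nonzero, to zero (up to the order in which the chain is listed). The sums in (ii) and (iii) are closed under complex conjugation and are understood as the corresponding real subspaces of $\mathbb R^n$.
   Formalization: In (v) only those Jordan chains are taken for which E_{ω_0}+⟨ũ_1,…,ũ_q⟩ is a synchrony subspace; without this (v) is false: arcs 1→1, 1→2, 2→3, 2→4 with the chain (e_2+e_3, e_3+e_4) give a space that is not polydiagonal. *)

theory Defs
  imports
    "HOL-Analysis.Analysis"
    "HOL-Combinatorics.Orbits"
    "Graph_Theory.Digraph_Component"
begin

text \<open>
  Networks are multi-digraphs whose cells are all elements of a finite type \<open>'n\<close>, so that the
  total phase space is \<open>real ^ 'n\<close>, with one coordinate per cell.
\<close>

definition one_input_network :: "('n::finite, 'e) pre_digraph \<Rightarrow> bool" where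
  "one_input_network G \<longleftrightarrow>
     fin_digraph G \<and> verts G = UNIV \<and> Digraph_Component.connected G \<and> (\<forall>v. in_degree G v = 1)"

definition adjacency_matrix :: "('n::finite, 'e) pre_digraph \<Rightarrow> real ^ 'n ^ 'n" where
  "adjacency_matrix G = (\<chi> i j. real (card {e \<in> arcs G. tail G e = j \<and> head G e = i}))"

definition input_cell :: "('n, 'e) pre_digraph \<Rightarrow> 'n \<Rightarrow> 'n" where
  "input_cell G v = tail G (THE e. e \<in> in_arcs G v)"

definition ring_cells :: "('n, 'e) pre_digraph \<Rightarrow> 'n set" where
  "ring_cells G = {v. v \<rightarrow>\<^sup>+\<^bsub>G\<^esub> v}"

definition leaf_cell :: "('n, 'e) pre_digraph \<Rightarrow> 'n \<Rightarrow> bool" where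
  "leaf_cell G v \<longleftrightarrow> v \<in> verts G \<and> out_degree G v = 0"

text \<open>
  A tail is the list of arcs of a directed path from a ring cell to a leaf. The path has to
  stay inside the tree rooted at its initial cell, hence it meets the ring only there.
\<close>

definition network_tails :: "('n, 'e) pre_digraph \<Rightarrow> 'e list set" where
  "network_tails G =
     {p. \<exists>r v. r \<in> ring_cells G \<and> leaf_cell G v \<and> pre_digraph.apath G r p v \<and>
         set (pre_digraph.awalk_verts G r p) \<inter> ring_cells G = {r}}"

text \<open>A tail is a nonempty arc list, since a leaf has no outgoing arc and so is not a ring cell.\<close>

definition tail_leaf :: "('n, 'e) pre_digraph \<Rightarrow> 'e list \<Rightarrow> 'n" where
  "tail_leaf G p = head G (last p)"

primrec C_k :: "nat \<Rightarrow> ('a::euclidean_space \<Rightarrow> real) \<Rightarrow> bool" where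
  "C_k 0 f \<longleftrightarrow> continuous_on UNIV f"
| "C_k (Suc k) f \<longleftrightarrow>
     (\<forall>x. f differentiable (at x)) \<and> (\<forall>b\<in>Basis. C_k k (\<lambda>x. frechet_derivative f (at x) b))"

definition smooth :: "('a::euclidean_space \<Rightarrow> real) \<Rightarrow> bool" where
  "smooth f \<longleftrightarrow> (\<forall>k. C_k k f)"

definition admissible :: "('n::finite, 'e) pre_digraph \<Rightarrow> (real ^ 'n \<Rightarrow> real ^ 'n) \<Rightarrow> bool" where
  "admissible G F \<longleftrightarrow>
     (\<exists>f :: real \<times> real \<Rightarrow> real. smooth f \<and> F = (\<lambda>x. \<chi> v. f (x $ v, x $ input_cell G v)))"

definition flow_invariant :: "('a::real_normed_vector \<Rightarrow> 'a) \<Rightarrow> 'a set \<Rightarrow> bool" where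
  "flow_invariant F S \<longleftrightarrow>
     (\<forall>x T. (\<forall>s\<in>{0..T}. (x has_vector_derivative F (x s)) (at s within {0..T})) \<and> x 0 \<in> S
        \<longrightarrow> (\<forall>s\<in>{0..T}. x s \<in> S))"

definition polydiagonal :: "(real ^ 'n) set \<Rightarrow> bool" where
  "polydiagonal W \<longleftrightarrow> (\<exists>R :: ('n \<times> 'n) set. W = {x. \<forall>(u, v)\<in>R. x $ u = x $ v})"

definition synchrony_subspaces :: "('n::finite, 'e) pre_digraph \<Rightarrow> (real ^ 'n) set set" where
  "synchrony_subspaces G = {W. polydiagonal W \<and> (\<forall>F. admissible G F \<longrightarrow> flow_invariant F W)}"

text \<open>
  The join is literally the sum \<open>X + Y = {x + y | x y. x \<in> X \<and> y \<in> Y}\<close> of subspaces. This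
  matters: a sum of two synchrony subspaces need not be polydiagonal, so a subspace that is
  not such a sum may still be the least upper bound, in the inclusion order, of two others.
\<close>

definition join_irreducible :: "'a::plus set set \<Rightarrow> 'a set \<Rightarrow> bool" where
  "join_irreducible V W \<longleftrightarrow>
     W \<in> V \<and> \<not> (\<exists>X\<in>V. \<exists>Y\<in>V. X \<noteq> W \<and> Y \<noteq> W \<and> W = X + Y)"

definition omega :: "nat \<Rightarrow> nat \<Rightarrow> complex" where
  "omega m j = exp (2 * complex_of_real pi * \<i> * of_nat j / of_nat m)"

definition eigenspace :: "complex ^ 'n ^ 'n \<Rightarrow> complex \<Rightarrow> (complex ^ 'n) set" where
  "eigenspace M z = {v. M *v v = z *s v}"

definition E_omega :: "real ^ 'n ^ 'n \<Rightarrow> nat \<Rightarrow> nat \<Rightarrow> (complex ^ 'n) set" where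
  "E_omega A m j = eigenspace (map_matrix complex_of_real A) (omega m j)"

text \<open>The real subspace underlying a conjugation-closed complex subspace.\<close>

definition real_points :: "(complex ^ 'n) set \<Rightarrow> (real ^ 'n) set" where
  "real_points S = {x. (\<chi> i. complex_of_real (x $ i)) \<in> S}"

definition zero_jordan_chain :: "real ^ 'n ^ 'n \<Rightarrow> (real ^ 'n) list \<Rightarrow> bool" where
  "zero_jordan_chain A us \<longleftrightarrow>
     length us \<ge> 2 \<and> (\<forall>j. Suc j < length us \<longrightarrow> A *v (us ! j) = us ! Suc j) \<and>
     last us \<noteq> 0 \<and> A *v last us = 0"

text \<open>
  In a chain of such vectors the index sets belonging to different vectors may overlap. The span
  of the chain and the all-ones vector is then not necessarily polydiagonal: for the self-loop
  at 1 with arcs 1 to 2, 2 to 3 and 2 to 4, take the chain e2 + e3, e3 + e4.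
\<close>

definition sum_of_axes :: "real ^ 'n \<Rightarrow> bool" where
  "sum_of_axes u \<longleftrightarrow> (\<exists>K. K \<noteq> {} \<and> u = (\<Sum>k\<in>K. axis k 1))"

end

theory Submission
  imports Defs "HOL-Number_Theory.Cong"
begin

text \<open>
  Every cell \<open>v\<close> has exactly one input cell \<open>p v\<close>, so the adjacency matrix acts on a state \<open>x\<close>, seen as
  a function on cells, by the composition \<open>x \<circ> p\<close> (the operator \<open>pull p\<close>). A polydiagonal subspace is
  flow-invariant under all admissible fields exactly when \<open>pull p\<close> preserves it
  (\<open>synchrony_subspaces_eq_balanced\<close>): the flow of the linear field \<open>pull p\<close> is itself a test, and
  conversely a Gronwall estimate keeps synchronous cells synchronous. In other words, a synchrony
  subspace is the space of functions on a quotient of the map \<open>p\<close>, and the task is to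
  find the quotients whose function space is not the sum of two function spaces of smaller quotients.

  Let \<open>W\<close> be join-irreducible. It is the sum of its \<open>m\<close>-periodic part and of its part that is constant
  on the ring, because the remainder \<open>x - x \<circ> p\<^sup>N\<close>, for a large multiple \<open>N\<close> of \<open>m\<close>, vanishes on the ring
  (\<open>split_periodic_ring_constant\<close>). Both parts are synchrony subspaces, hence \<open>W\<close> equals one of them.

  If \<open>W\<close> is \<open>m\<close>-periodic, then it consists of all functions of period \<open>s\<close> for a divisor \<open>s\<close> of \<open>m\<close>
  (\<open>balanced_subspace_of_periodic_space\<close>), which by a discrete Fourier expansion is the sum of the
  eigenspaces for the \<open>s\<close>-th roots of unity (\<open>real_points_sum_E_omega\<close>); these are the families (i),
  (ii) and (iii).

  If \<open>W\<close> is constant on the ring, consider two cells that are not synchronous in \<open>W\<close> although their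
  inputs are. Identifying them gives a synchrony subspace of codimension one in \<open>W\<close>, and two distinct
  hyperplanes add up to \<open>W\<close>; so there is at most one such pair of classes
  (\<open>critical_pair_unique\<close>). Hence the quotient tree does not branch: it is a path that hangs from the
  class of the ring, and the indicators of the levels below the ring form a Jordan chain for zero
  (\<open>join_irreducible_ring_constant_krylov\<close>). A chain of length one is the indicator of a set of leaves,
  which is family (iv), and the longer chains are family (v).

  Conversely, a proper synchrony subspace of a space of period \<open>s\<close> has a period \<open>a < s\<close>, and the second
  difference \<open>(A\<^sup>a - 1)(A\<^sup>b - 1)\<close> annihilates the sum of two such subspaces but not the whole space
  (\<open>join_irreducible_periodic_space\<close>). For a chain of length \<open>q\<close>, all proper synchrony
  subspaces lie in the kernel of the single operator \<open>A\<^sup>q\<^sup>-\<^sup>1(A - 1)\<close>, so that their sums do, too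
  (\<open>join_irreducible_krylov\<close>).
\<close>

section \<open>Synchrony is invariance under the adjacency operator\<close>

definition pull :: "('n \<Rightarrow> 'n) \<Rightarrow> real ^ 'n \<Rightarrow> real ^ 'n" where
  "pull p x = (\<chi> v. x $ p v)"

definition balanced_subspaces :: "('n \<Rightarrow> 'n) \<Rightarrow> (real ^ 'n) set set" where
  "balanced_subspaces p = {W. polydiagonal W \<and> (\<forall>x\<in>W. pull p x \<in> W)}"

lemma pull_nth [simp]: "pull p x $ v = x $ p v"
  by (simp add: pull_def)

text \<open>
  A polydiagonal subspace is determined by the pairs of cells that are synchronous on it. This replaces
  the arbitrary relation in its definition by an equivalence relation that depends on the subspace alone.
\<close>

lemma polydiagonal_kernel:
  assumes "polydiagonal W"
  shows "x \<in> W \<longleftrightarrow> (\<forall>u v. (\<forall>y\<in>W. y $ u = y $ v) \<longrightarrow> x $ u = x $ v)"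
proof -
  obtain R where R: "W = {x. \<forall>(u, v)\<in>R. x $ u = x $ v}"
    using assms unfolding polydiagonal_def by blast
  show ?thesis
  proof
    assume "\<forall>u v. (\<forall>y\<in>W. y $ u = y $ v) \<longrightarrow> x $ u = x $ v"
    moreover have "\<forall>y\<in>W. y $ u = y $ v" if "(u, v) \<in> R" for u v
      using that R by blast
    ultimately show "x \<in> W" unfolding R by blast
  qed blast
qed

lemma polydiagonal_subspace: "polydiagonal (W :: (real ^ 'n) set) \<Longrightarrow> subspace W"
  unfolding polydiagonal_def
proof (elim exE)
  fix R assume W: "W = {x. \<forall>(u, v)\<in>R. x $ u = x $ v}"
  show "subspace W"
    unfolding W case_prod_unfold by (rule subspaceI) simp_all
qed

lemma C_k_const: "C_k k (\<lambda>x. c)"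
  by (induction k arbitrary: c) (auto simp: frechet_derivative_const)

text \<open>
  The derivative of a bounded linear map is constant, so the iterated derivatives are constant functions
  from the first one on.
\<close>

lemma smooth_bounded_linear:
  assumes "bounded_linear f"
  shows "smooth f"
  unfolding smooth_def
proof
  fix k
  have "(f has_derivative f) (at x)" for x
    by (rule bounded_linear_imp_has_derivative[OF assms])
  then have der: "f differentiable at x" "frechet_derivative f (at x) = f" for x
    using frechet_derivative_at[of f f x] by (auto simp: differentiable_def)
  show "C_k k f"
    by (cases k) (use assms in \<open>auto simp: der linear_continuous_on C_k_const\<close>)
qed

text \<open>
  Local Lipschitz continuity is all that the uniqueness of trajectories needs from smoothness. The two
  continuous partial derivatives are bounded on the compact ball, and the mean value theorem
  applies because the ball is convex.
\<close>

lemma smooth_Lipschitz_on_cball: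
  fixes f :: "real \<times> real \<Rightarrow> real"
  assumes "smooth f"
  obtains L where "L \<ge> 0"
    "\<And>a b. \<lbrakk>a \<in> cball 0 r; b \<in> cball 0 r\<rbrakk> \<Longrightarrow> \<bar>f a - f b\<bar> \<le> L * norm (a - b)"
proof -
  let ?f' = "\<lambda>x. frechet_derivative f (at x)"
  have C1: "C_k (Suc 0) f" using assms smooth_def by blast
  then have der: "(f has_derivative ?f' x) (at x)" for x
    using frechet_derivative_works[of f "at x"] by (simp only: C_k.simps)
  have bounded: "\<exists>M\<ge>0. \<forall>x\<in>cball 0 r. \<bar>?f' x b\<bar> \<le> M" if "b \<in> Basis" for b
  proof -
    have "continuous_on (cball 0 r) (\<lambda>x. ?f' x b)"
      using C1 that by (auto intro: continuous_on_subset)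
    then have "compact ((\<lambda>x. ?f' x b) ` cball 0 r)"
      by (intro compact_continuous_image) auto
    then obtain M where "\<forall>y\<in>(\<lambda>x. ?f' x b) ` cball 0 r. norm y \<le> M"
      using compact_imp_bounded bounded_iff by metis
    then have "\<bar>?f' x b\<bar> \<le> max M 0" if "x \<in> cball 0 r" for x
      using that by (simp add: le_max_iff_disj)
    then show ?thesis by (intro exI[of _ "max M 0"]) simp
  qed
  obtain M1 where M1: "M1 \<ge> 0" "\<And>x. x \<in> cball 0 r \<Longrightarrow> \<bar>?f' x (1, 0)\<bar> \<le> M1"
    using bounded[of "(1, 0)"] by (auto simp: Basis_prod_def)
  obtain M2 where M2: "M2 \<ge> 0" "\<And>x. x \<in> cball 0 r \<Longrightarrow> \<bar>?f' x (0, 1)\<bar> \<le> M2"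
    using bounded[of "(0, 1)"] by (auto simp: Basis_prod_def)
  have onorm: "onorm (?f' x) \<le> M1 + M2" if x: "x \<in> cball 0 r" for x
  proof (rule onorm_le)
    fix h :: "real \<times> real"
    have lin: "linear (?f' x)" using der has_derivative_linear by blast
    have "h = fst h *\<^sub>R (1, 0) + snd h *\<^sub>R (0, 1)" by (cases h) auto
    then have "?f' x h = ?f' x (fst h *\<^sub>R (1, 0) + snd h *\<^sub>R (0, 1))" by simp
    also have "\<dots> = fst h * ?f' x (1, 0) + snd h * ?f' x (0, 1)"
      by (simp add: linear_add[OF lin] linear_scale[OF lin] del: scaleR_Pair)
    finally have "norm (?f' x h) \<le> \<bar>fst h\<bar> * \<bar>?f' x (1, 0)\<bar> + \<bar>snd h\<bar> * \<bar>?f' x (0, 1)\<bar>"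
      by (simp add: abs_mult[symmetric])
    also have "\<dots> \<le> norm h * M1 + norm h * M2"
      using M1 M2 x norm_fst_le[of "fst h" "snd h"] norm_snd_le[of "snd h" "fst h"]
      by (intro add_mono mult_mono) auto
    finally show "norm (?f' x h) \<le> (M1 + M2) * norm h" by (simp add: algebra_simps)
  qed
  show ?thesis
  proof (rule that[of "M1 + M2"])
    fix a b :: "real \<times> real"
    assume "a \<in> cball 0 r" "b \<in> cball 0 r"
    then show "\<bar>f a - f b\<bar> \<le> (M1 + M2) * norm (a - b)"
      using differentiable_bound[OF convex_cball, of 0 r f ?f' "M1 + M2" a b] onorm
        has_derivative_at_withinI[OF der] by auto
  qed (use M1 M2 in auto)
qed

text \<open>
  The product of \<open>D\<close> with \<open>exp (- C s)\<close> has nonpositive derivative and starts at zero.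
\<close>

lemma Gronwall_zero:
  fixes D D' :: "real \<Rightarrow> real"
  assumes der: "\<And>s. s \<in> {0..T} \<Longrightarrow> (D has_real_derivative D' s) (at s within {0..T})"
    and bound: "\<And>s. s \<in> {0..T} \<Longrightarrow> D' s \<le> C * D s"
    and nonneg: "\<And>s. s \<in> {0..T} \<Longrightarrow> D s \<ge> 0"
    and "D 0 = 0" and s: "s \<in> {0..T}"
  shows "D s = 0"
proof (cases "s = 0")
  case False
  let ?g = "\<lambda>s. D s * exp (- C * s)"
  have g': "(?g has_real_derivative (D' z - C * D z) * exp (- C * z)) (at z within {0..s})"
    if "z \<in> {0..s}" for z
  proof -
    have "(D has_real_derivative D' z) (at z within {0..s})"
      using der[of z] that s by (auto intro: DERIV_subset)
    then show ?thesis
      by (auto intro!: derivative_eq_intros simp: algebra_simps)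
  qed
  obtain z where z: "z \<in> {0<..<s}" "?g s - ?g 0 = (D' z - C * D z) * exp (- C * z) * (s - 0)"
    using mvt_simple[of 0 s ?g "\<lambda>z h. (D' z - C * D z) * exp (- C * z) * h"] g' s False
    by (auto simp: has_field_derivative_def)
  have "(D' z - C * D z) * exp (- C * z) * (s - 0) \<le> 0"
    using bound[of z] z s by (intro mult_nonpos_nonneg) auto
  then have "?g s \<le> 0" using z \<open>D 0 = 0\<close> by simp
  then have "D s \<le> 0" by (simp add: mult_le_0_iff)
  then show ?thesis using nonneg[OF s] by simp
qed (use assms in simp)

text \<open>
  The flow is the exponential series \<open>\<Sum>k. s^k / k! \<cdot> x\<^sub>0 \<circ> p^k\<close>. It is built cell by cell, where it
  is a scalar power series with bounded coefficients, and shifting the coefficients of the series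
  at \<open>v\<close> gives those of the series at \<open>p v\<close>.
\<close>

lemma pull_flow_exists:
  fixes p :: "'n::finite \<Rightarrow> 'n"
  obtains x where "x 0 = x0" "\<And>s. (x has_vector_derivative pull p (x s)) (at s)"
proof -
  define c where "c v k = x0 $ (p ^^ k) v / fact k" for v k
  define x where "x s = (\<chi> v. \<Sum>k. c v k * s ^ k)" for s :: real
  have summ: "summable (\<lambda>k. c v k * s ^ k)" for v s
  proof (rule summable_comparison_test)
    let ?M = "Max (range (\<lambda>v. \<bar>x0 $ v\<bar>))"
    show "\<exists>N. \<forall>k\<ge>N. norm (c v k * s ^ k) \<le> ?M * (inverse (fact k) * \<bar>s\<bar> ^ k)"
    proof (intro exI[of _ 0] allI impI)
      fix k :: nat
      have "\<bar>x0 $ (p ^^ k) v\<bar> \<le> ?M" by (intro Max_ge) auto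
      then have "\<bar>x0 $ (p ^^ k) v\<bar> * (inverse (fact k) * \<bar>s\<bar> ^ k) \<le> ?M * (inverse (fact k) * \<bar>s\<bar> ^ k)"
        by (intro mult_right_mono) auto
      then show "norm (c v k * s ^ k) \<le> ?M * (inverse (fact k) * \<bar>s\<bar> ^ k)"
        by (simp add: c_def abs_mult power_abs field_simps)
    qed
    show "summable (\<lambda>k. ?M * (inverse (fact k) * \<bar>s\<bar> ^ k))"
      by (intro summable_mult summable_exp)
  qed
  have diffs: "diffs (c v) = c (p v)" for v
    by (auto simp: diffs_def c_def fun_eq_iff funpow_swap1 simp del: funpow.simps)
       (simp add: field_simps funpow_swap1)
  show ?thesis
  proof (rule that[of x])
    have "(\<Sum>k. c v k * 0 ^ k) = x0 $ v" for v
      by (subst powser_zero) (simp add: c_def)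
    then show "x 0 = x0" by (simp add: x_def vec_eq_iff)
    fix s
    have "((\<lambda>s. \<Sum>k. c v k * s ^ k) has_real_derivative (\<Sum>k. c (p v) k * s ^ k)) (at s)" for v
      using termdiffs_strong_converges_everywhere[of "c v" s] summ diffs by simp
    then have "((\<lambda>s. x s $ v) has_derivative (\<lambda>h. h * pull p (x s) $ v)) (at s)" for v
      by (simp add: x_def has_field_derivative_def mult.commute[of _ "\<Sum>k. _ k"])
    then show "(x has_vector_derivative pull p (x s)) (at s)"
      unfolding has_vector_derivative_def
      by (subst has_derivative_componentwise_within) (auto simp: Basis_vec_def inner_axis)
  qed
qed

text \<open>
  The Gronwall estimate is applied to the total squared defect of synchrony, summed over
  all synchronous pairs at once: the derivative of the defect of \<open>(u, v)\<close> involves the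
  defect of \<open>(p u, p v)\<close>, and this pair occurs in the same sum because the subspace is invariant.
\<close>

lemma flow_invariant_if_balanced:
  assumes W: "W \<in> balanced_subspaces p" and f: "smooth f"
  shows "flow_invariant (\<lambda>x :: real ^ 'n::finite. \<chi> v. f (x $ v, x $ p v)) W"
  unfolding flow_invariant_def
proof (intro allI impI ballI, elim conjE)
  fix x :: "real \<Rightarrow> real ^ 'n" and T s :: real
  assume sol: "\<forall>s\<in>{0..T}. (x has_vector_derivative (\<chi> v. f (x s $ v, x s $ p v))) (at s within {0..T})"
    and x0: "x 0 \<in> W" and s: "s \<in> {0..T}"
  define R where "R = {(u, v). \<forall>y\<in>W. y $ u = y $ v}"
  have mem: "y \<in> W \<longleftrightarrow> (\<forall>(u, v)\<in>R. y $ u = y $ v)" for y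
    using polydiagonal_kernel[of W y] W by (auto simp: balanced_subspaces_def R_def)
  have R_step: "(p u, p v) \<in> R" if "(u, v) \<in> R" for u v
  proof -
    have "y $ p u = y $ p v" if "y \<in> W" for y
    proof -
      have "pull p y \<in> W" using W that by (simp add: balanced_subspaces_def)
      then have "pull p y $ u = pull p y $ v" using \<open>(u, v) \<in> R\<close> unfolding R_def by blast
      then show ?thesis by simp
    qed
    then show ?thesis by (simp add: R_def)
  qed
  have der: "((\<lambda>s. x s $ v) has_real_derivative f (x z $ v, x z $ p v)) (at z within {0..T})"
    if "z \<in> {0..T}" for z v
    using bounded_linear.has_vector_derivative[OF bounded_linear_vec_nth, of x _ "at z within {0..T}" v] sol that
    by (fastforce simp: has_real_derivative_iff_has_vector_derivative)
  have "continuous_on {0..T} x"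
    using sol by (auto intro: continuous_at_imp_continuous_on has_vector_derivative_continuous
        simp: continuous_on_eq_continuous_within)
  then have "bounded (x ` {0..T})"
    by (intro compact_imp_bounded compact_continuous_image) auto
  then obtain B where B: "\<And>z. z \<in> {0..T} \<Longrightarrow> norm (x z) \<le> B"
    unfolding bounded_iff by blast
  have in_ball: "(x z $ u, x z $ v) \<in> cball 0 (2 * B)" if "z \<in> {0..T}" for z u v
    using norm_Pair_le[of "x z $ u" "x z $ v"] B[OF that] component_le_norm_cart[of "x z" u]
      component_le_norm_cart[of "x z" v] by simp
  obtain L where L: "L \<ge> 0"
    "\<And>a b. \<lbrakk>a \<in> cball 0 (2 * B); b \<in> cball 0 (2 * B)\<rbrakk> \<Longrightarrow> \<bar>f a - f b\<bar> \<le> L * norm (a - b)"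
    using smooth_Lipschitz_on_cball[OF f, of "2 * B"] by metis
  define \<delta> where "\<delta> z u v = x z $ u - x z $ v" for z u v
  define D where "D z = (\<Sum>(u, v)\<in>R. (\<delta> z u v)\<^sup>2)" for z
  define D' where "D' z = (\<Sum>(u, v)\<in>R. 2 * \<delta> z u v *
    (f (x z $ u, x z $ p u) - f (x z $ v, x z $ p v)))" for z
  have le_D: "(\<delta> z u v)\<^sup>2 \<le> D z" if "(u, v) \<in> R" for z u v
    unfolding D_def using member_le_sum[of "(u, v)" R "\<lambda>(u, v). (\<delta> z u v)\<^sup>2"] that by auto
  have "D s = 0"
  proof (rule Gronwall_zero[of T D D' "4 * L * card R"])
    fix z assume z: "z \<in> {0..T}"
    show "(D has_real_derivative D' z) (at z within {0..T})"
      unfolding D_def D'_def \<delta>_def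
      by (rule DERIV_sum) (auto intro!: derivative_eq_intros der z)
    show "D z \<ge> 0" unfolding D_def by (intro sum_nonneg) auto
    have "D' z \<le> (\<Sum>(u, v)\<in>R. 4 * L * D z)"
      unfolding D'_def
    proof (rule sum_mono, clarify)
      fix u v assume uv: "(u, v) \<in> R"
      let ?a = "\<bar>\<delta> z u v\<bar>" and ?b = "\<bar>\<delta> z (p u) (p v)\<bar>"
      have "\<bar>f (x z $ u, x z $ p u) - f (x z $ v, x z $ p v)\<bar> \<le> L * norm (\<delta> z u v, \<delta> z (p u) (p v))"
        using L(2)[OF in_ball in_ball, OF z z] by (simp add: \<delta>_def)
      also have "\<dots> \<le> L * (?a + ?b)"
        using L(1) norm_Pair_le[of "\<delta> z u v" "\<delta> z (p u) (p v)"] by (intro mult_left_mono) auto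
      finally have "2 * \<delta> z u v * (f (x z $ u, x z $ p u) - f (x z $ v, x z $ p v)) \<le> 2 * ?a * (L * (?a + ?b))"
        by - (rule order_trans[OF abs_ge_self], simp add: abs_mult mult_left_mono)
      also have "\<dots> = L * (2 * ?a\<^sup>2 + 2 * ?a * ?b)" by (simp add: algebra_simps power2_eq_square)
      also have "\<dots> \<le> L * (3 * ?a\<^sup>2 + ?b\<^sup>2)"
        using L(1) sum_squares_bound[of ?a ?b] by (intro mult_left_mono) auto
      also have "\<dots> \<le> L * (4 * D z)"
        using L(1) le_D[OF uv, of z] le_D[OF R_step[OF uv], of z] by (intro mult_left_mono) auto
      finally show "2 * \<delta> z u v * (f (x z $ u, x z $ p u) - f (x z $ v, x z $ p v)) \<le> 4 * L * D z"
        by simp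
    qed
    then show "D' z \<le> 4 * L * card R * D z" by (simp add: mult_ac)
  next
    show "D 0 = 0" using x0 mem[of "x 0"] unfolding D_def \<delta>_def by (intro sum.neutral) auto
  qed (rule s)
  then have "x s $ u = x s $ v" if "(u, v) \<in> R" for u v
    using le_D[OF that, of s] by (simp add: \<delta>_def)
  then show "x s \<in> W" by (auto simp: mem)
qed

text \<open>
  Differentiating at time zero a trajectory that stays in \<open>W\<close> shows that its initial velocity, the
  vector \<open>pull p y\<close>, satisfies the equalities that define \<open>W\<close>.
\<close>

lemma balanced_if_flow_invariant:
  fixes p :: "'n::finite \<Rightarrow> 'n"
  assumes W: "polydiagonal W" and flow: "flow_invariant (pull p) W" and y: "y \<in> W"
  shows "pull p y \<in> W"
proof -
  obtain x where x: "x 0 = y" "\<And>s. (x has_vector_derivative pull p (x s)) (at s)"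
    using pull_flow_exists by blast
  have stay: "x s \<in> W" if "s \<in> {0..1}" for s
    using flow x y that unfolding flow_invariant_def
    by (metis has_vector_derivative_at_within)
  have "pull p y $ u = pull p y $ v" if uv: "\<forall>z\<in>W. z $ u = z $ v" for u v
  proof -
    have der: "((\<lambda>s. x s $ w) has_vector_derivative y $ p w) (at 0 within {0..1})" for w
      using bounded_linear.has_vector_derivative[OF bounded_linear_vec_nth, of x _ _ w]
        has_vector_derivative_at_within[OF x(2)[of 0]] x(1) by fastforce
    have "((\<lambda>s. x s $ v) has_vector_derivative y $ p u) (at 0 within {0..1})"
      using uv stay by (intro has_vector_derivative_transform[OF _ _ der[of u]]) auto
    then show ?thesis
      using vector_derivative_unique_within[of 0 "{0..1}"] der[of v]
      by (simp add: trivial_limit_within islimpt_Icc)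
  qed
  then show ?thesis using polydiagonal_kernel[OF W] by blast
qed

section \<open>Jordan chains and functions constant on classes\<close>

lemma linear_pull: "linear (pull p)"
  by (rule linearI) (simp_all add: vec_eq_iff)

lemma pull_one [simp]: "pull p 1 = 1"
  by (simp add: vec_eq_iff)

lemma pull_funpow_nth [simp]: "(pull p ^^ k) x $ v = x $ (p ^^ k) v"
  by (induction k arbitrary: v) (simp_all, simp add: funpow_swap1)

lemma balanced_subspace: "W \<in> balanced_subspaces p \<Longrightarrow> subspace W"
  unfolding balanced_subspaces_def using polydiagonal_subspace by blast

lemma one_in_polydiagonal: "polydiagonal W \<Longrightarrow> 1 \<in> W"
  unfolding polydiagonal_def by auto

lemma linear_funpow:
  fixes f :: "'a::real_vector \<Rightarrow> 'a"
  shows "linear f \<Longrightarrow> linear (f ^^ k)"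
  by (induction k) (auto intro: linear_compose linear_id)

lemma funpow_linear_kills:
  fixes f :: "'a::real_vector \<Rightarrow> 'a"
  assumes "linear f" and "(f ^^ n) u = 0"
  shows "(f ^^ n) ((f ^^ j) u) = 0"
proof -
  have "(f ^^ n) ((f ^^ j) u) = (f ^^ (n + j)) u" by (simp add: funpow_add)
  also have "\<dots> = (f ^^ (j + n)) u" by (simp add: add.commute)
  also have "\<dots> = (f ^^ j) 0" using assms(2) by (simp add: funpow_add)
  finally show ?thesis using linear_0[OF linear_funpow[OF assms(1)]] by simp
qed

lemma balanced_summands:
  assumes "X \<in> balanced_subspaces p" "Y \<in> balanced_subspaces p"
  shows "X \<subseteq> X + Y" "Y \<subseteq> X + Y"
proof -
  have "0 \<in> X" "0 \<in> Y" using assms balanced_subspace subspace_0 by blast+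
  then show "X \<subseteq> X + Y" "Y \<subseteq> X + Y"
    by (auto simp: set_plus_def) (metis add.right_neutral, metis add.left_neutral)
qed

text \<open>
  The vectors \<open>u, A u, \<dots>, A\<^sup>k u\<close>. When \<open>A\<^sup>k u\<close> is a nonzero element of the kernel of \<open>A\<close>, this is a Jordan chain of length \<open>k + 1\<close> for zero.
\<close>

definition krylov :: "('a \<Rightarrow> 'a) \<Rightarrow> nat \<Rightarrow> 'a \<Rightarrow> 'a set" where
  "krylov A k u = (\<lambda>j. (A ^^ j) u) ` {..k}"

lemma krylov_0: "krylov A 0 u = {u}"
  by (simp add: krylov_def)

lemma krylov_Suc: "krylov A (Suc k) u = insert u (krylov A k (A u))"
  unfolding krylov_def atMost_Suc_eq_insert_0
  by (simp add: image_image funpow_swap1)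

text \<open>
  Applying \<open>A\<^sup>k\<close> to a representation \<open>u = c e + w\<close> kills \<open>w\<close> and leaves \<open>A\<^sup>k u = c e\<close>; one more
  application of \<open>A\<close> gives \<open>c e = 0\<close>, although \<open>A\<^sup>k u\<close> is not zero.
\<close>

lemma nilpotent_not_in_span:
  fixes A :: "'a::real_vector \<Rightarrow> 'a"
  assumes A: "linear A" and e: "A e = e" "e \<noteq> 0"
    and u: "(A ^^ k) u \<noteq> 0" "(A ^^ Suc k) u = 0"
    and K: "\<And>w. w \<in> K \<Longrightarrow> (A ^^ k) w = 0"
  shows "u \<notin> span (insert e K)"
proof
  note Ak = linear_funpow[OF A, of k]
  assume "u \<in> span (insert e K)"
  then obtain c where "u - c *\<^sub>R e \<in> span K" using span_breakdown_eq by blast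
  then have "(A ^^ k) (u - c *\<^sub>R e) = 0"
    using linear_eq_0_on_span[OF Ak] K by blast
  moreover have "(A ^^ k) e = e" using e by (induction k) auto
  ultimately have eq: "(A ^^ k) u = c *\<^sub>R e" by (simp add: linear_diff[OF Ak] linear_scale[OF Ak])
  then have "c *\<^sub>R e = 0" using u(2) by (simp add: linear_scale[OF A] e)
  then show False using eq u by simp
qed

text \<open>
  The vector \<open>e\<close> is the all-ones vector in the application. Induction removes the top of the chain,
  which is not killed by the power of \<open>A\<close> that kills all the vectors below it.
\<close>

lemma dim_krylov:
  fixes A :: "'a::euclidean_space \<Rightarrow> 'a"
  assumes A: "linear A" and e: "A e = e" "e \<noteq> 0"
  shows "\<lbrakk>(A ^^ k) u \<noteq> 0; (A ^^ Suc k) u = 0\<rbrakk> \<Longrightarrow> dim (insert e (krylov A k u)) = k + 2"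
proof (induction k arbitrary: u)
  case 0
  then have "u \<notin> span (insert e {})"
    by (intro nilpotent_not_in_span[OF A e, of 0]) auto
  then have "dim (insert u {e}) = 2" using e by (simp add: dim_insert)
  then show ?case by (simp add: krylov_0 insert_commute)
next
  case (Suc k)
  have "u \<notin> span (insert e (krylov A k (A u)))"
  proof (rule nilpotent_not_in_span[OF A e Suc.prems])
    fix w assume "w \<in> krylov A k (A u)"
    then obtain j where j: "w = (A ^^ j) (A u)" by (auto simp: krylov_def)
    have "(A ^^ Suc k) (A u) = 0" using Suc.prems(2) by (simp add: funpow_swap1)
    then show "(A ^^ Suc k) w = 0" unfolding j by (rule funpow_linear_kills[OF A])
  qed
  moreover have "dim (insert e (krylov A k (A u))) = k + 2"
    using Suc.prems by (intro Suc.IH) (simp_all add: funpow_swap1)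
  ultimately show ?case
    by (simp add: krylov_Suc insert_commute[of e u] dim_insert)
qed

text \<open>
  The map \<open>A - 1\<close> removes the component along \<open>e\<close>, so \<open>y = A x - x\<close> generates a chain of at most
  the length of the given one. If \<open>A\<^sup>k y\<close> were not zero, this chain would be as long as the given one
  and would span, together with \<open>e\<close>, a subspace of \<open>X\<close> of full dimension.
\<close>

lemma proper_invariant_subspace_of_krylov:
  fixes A :: "'a::euclidean_space \<Rightarrow> 'a"
  assumes A: "linear A" and e: "A e = e" "e \<noteq> 0"
    and u: "(A ^^ k) u \<noteq> 0" "(A ^^ Suc k) u = 0"
    and X: "subspace X" "\<And>x. x \<in> X \<Longrightarrow> A x \<in> X" "e \<in> X"
    and sub: "X \<subset> span (insert e (krylov A k u))" and x: "x \<in> X"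
  shows "(A ^^ k) (A x - x) = 0"
proof (rule ccontr)
  assume neq: "(A ^^ k) (A x - x) \<noteq> 0"
  let ?W = "span (insert e (krylov A k u))"
  define y where "y = A x - x"
  note Ak = linear_funpow[OF A, of "Suc k"]
  have "linear (\<lambda>w. (A ^^ Suc k) (A w - w))"
    using linear_compose[OF linear_compose_sub[OF A linear_ident] Ak] by (simp add: o_def)
  moreover have "(A ^^ Suc k) (A w - w) = 0" if "w \<in> insert e (krylov A k u)" for w
  proof (cases "w = e")
    case False
    then obtain j where "w = (A ^^ j) u" using \<open>w \<in> _\<close> by (auto simp: krylov_def)
    then have w0: "(A ^^ Suc k) w = 0"
      using funpow_linear_kills[OF A u(2)] by simp
    then have "(A ^^ Suc k) (A w) = 0"
      using funpow_linear_kills[OF A w0, of 1] by simp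
    then show ?thesis using w0 by (subst linear_diff[OF Ak]) (simp del: funpow.simps)
  qed (use e linear_0[OF Ak] in simp)
  ultimately have y0: "(A ^^ Suc k) y = 0"
    unfolding y_def using linear_eq_0_on_span x sub by blast
  have yX: "(A ^^ j) y \<in> X" for j
    by (induction j) (use X x in \<open>auto simp: y_def subspace_diff\<close>)
  then have "span (insert e (krylov A k y)) \<subseteq> X"
    using X by (intro span_minimal) (auto simp: krylov_def)
  moreover have "dim (span (insert e (krylov A k y))) = dim ?W"
    using dim_krylov[OF A e] u y0 neq by (simp add: y_def del: funpow.simps)
  ultimately have "dim ?W \<le> dim X" using dim_subset by metis
  then have "X = ?W" using sub X(1) by (intro subspace_dim_equal) auto
  then show False using sub by blast
qed

text \<open>
  The proper synchrony subspaces are all contained in the kernel of the one operator \<open>A\<^sup>k (A - 1)\<close>, and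
  this kernel does not contain \<open>u\<close>.
\<close>

lemma join_irreducible_krylov:
  fixes p :: "'n::finite \<Rightarrow> 'n"
  assumes u: "(pull p ^^ k) u \<noteq> 0" "(pull p ^^ Suc k) u = 0"
    and W: "span (insert 1 (krylov (pull p) k u)) \<in> balanced_subspaces p" (is "?W \<in> _")
  shows "join_irreducible (balanced_subspaces p) ?W"
  unfolding join_irreducible_def
proof (intro conjI W notI, elim bexE conjE)
  fix X Y assume XY: "X \<in> balanced_subspaces p" "Y \<in> balanced_subspaces p"
    "X \<noteq> ?W" "Y \<noteq> ?W" "?W = X + Y"
  have killed: "(pull p ^^ k) (pull p z - z) = 0"
    if "Z \<in> balanced_subspaces p" "Z \<subset> ?W" "z \<in> Z" for Z z
    using that balanced_subspace[of Z p] one_in_polydiagonal[of Z]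
    by (intro proper_invariant_subspace_of_krylov[OF linear_pull _ _ u])
      (auto simp: balanced_subspaces_def)
  have "X \<subset> ?W" "Y \<subset> ?W" using XY balanced_summands[OF XY(1,2)] by auto
  have "u \<in> ?W" by (intro span_base) (auto simp: krylov_def image_iff intro: bexI[of _ 0])
  then obtain x y where xy: "x \<in> X" "y \<in> Y" "u = x + y"
    unfolding XY by (auto elim: set_plus_elim)
  note Ak = linear_funpow[OF linear_pull[of p], of k]
  have "(pull p ^^ k) (pull p u - u) = (pull p ^^ k) (pull p x - x) + (pull p ^^ k) (pull p y - y)"
    unfolding xy linear_add[OF Ak, symmetric] linear_add[OF linear_pull] by (simp add: algebra_simps)
  also have "\<dots> = 0"
    using killed XY \<open>X \<subset> ?W\<close> \<open>Y \<subset> ?W\<close> xy by simp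
  finally have "(pull p ^^ k) u = (pull p ^^ k) (pull p u)"
    by (simp add: linear_diff[OF Ak])
  moreover have "(pull p ^^ k) (pull p u) = 0" using u(2) by (simp add: funpow_swap1)
  ultimately show False using u(1) by simp
qed

definition indicator_vec :: "'n set \<Rightarrow> real ^ 'n" where
  "indicator_vec S = (\<chi> v. if v \<in> S then 1 else 0)"

lemma indicator_vec_nth [simp]: "indicator_vec S $ v = (if v \<in> S then 1 else 0)"
  by (simp add: indicator_vec_def)

lemma indicator_vec_eq_0_iff [simp]: "indicator_vec S = 0 \<longleftrightarrow> S = {}"
  by (auto simp: vec_eq_iff)

lemma indicator_vec_conv_sum:
  fixes S :: "'n::finite set"
  shows "indicator_vec S = (\<Sum>v\<in>S. axis v 1)"
  by (simp add: vec_eq_iff axis_def)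

lemma pull_indicator_vec: "pull p (indicator_vec S) = indicator_vec (p -` S)"
  by (simp add: vec_eq_iff)

definition level_space :: "('n \<Rightarrow> 'k) \<Rightarrow> (real ^ 'n) set" where
  "level_space q = {x. \<forall>u v. q u = q v \<longrightarrow> x $ u = x $ v}"

lemma level_spaceD: "\<lbrakk>x \<in> level_space q; q u = q v\<rbrakk> \<Longrightarrow> x $ u = x $ v"
  unfolding level_space_def by blast

lemma polydiagonal_level_space: "polydiagonal (level_space q)"
  unfolding polydiagonal_def level_space_def
  by (intro exI[of _ "{(u, v). q u = q v}"]) auto

text \<open>
  A function that is constant on the levels of \<open>q\<close> is the combination of the level indicators
  with its values as coefficients.
\<close>

lemma level_space_eq_span:
  fixes q :: "'n::finite \<Rightarrow> 'k"
  shows "level_space q = span ((\<lambda>i. indicator_vec (q -` {i})) ` range q)" (is "_ = span ?B")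
proof
  show "level_space q \<subseteq> span ?B"
  proof
    fix x assume x: "x \<in> level_space q"
    have "(\<Sum>i\<in>range q. x $ inv q i *\<^sub>R indicator_vec (q -` {i})) $ v = x $ v" for v
    proof -
      have "(\<Sum>i\<in>range q. x $ inv q i *\<^sub>R indicator_vec (q -` {i})) $ v
          = (\<Sum>i\<in>range q. if i = q v then x $ inv q i else 0)"
        unfolding sum_component by (intro sum.cong) auto
      also have "\<dots> = x $ inv q (q v)" by simp
      also have "q (inv q (q v)) = q v" by (simp add: f_inv_into_f)
      then have "x $ inv q (q v) = x $ v" using x unfolding level_space_def by blast
      finally show ?thesis .
    qed
    then have "x = (\<Sum>i\<in>range q. x $ inv q i *\<^sub>R indicator_vec (q -` {i}))"
      by (simp add: vec_eq_iff)
    moreover have "\<dots> \<in> span ?B" by (intro span_sum span_scale span_base) auto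
    ultimately show "x \<in> span ?B" by simp
  qed
  show "span ?B \<subseteq> level_space q"
    using polydiagonal_subspace[OF polydiagonal_level_space]
    by (intro span_minimal) (auto simp: level_space_def)
qed

text \<open>
  The indicators of distinct levels are nonzero and have disjoint supports, so they are orthogonal.
\<close>

lemma dim_level_space:
  fixes q :: "'n::finite \<Rightarrow> 'k"
  shows "dim (level_space q) = card (range q)"
proof -
  let ?f = "\<lambda>i. indicator_vec (q -` {i})"
  have inner: "?f i \<bullet> ?f j = 0" if "i \<noteq> j" for i j
    using that by (auto simp: inner_vec_def intro!: sum.neutral)
  have "q -` {q v} \<noteq> {}" for v by blast
  then have "0 \<notin> ?f ` range q" by auto
  moreover have "pairwise orthogonal (?f ` range q)"
  proof (rule pairwiseI)
    fix x y assume "x \<in> ?f ` range q" "y \<in> ?f ` range q" and "x \<noteq> y"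
    then obtain i j where xy: "x = ?f i" "y = ?f j" by blast
    then have "i \<noteq> j" using \<open>x \<noteq> y\<close> by blast
    then show "orthogonal x y" unfolding orthogonal_def xy by (rule inner)
  qed
  ultimately have "independent (?f ` range q)"
    by (intro pairwise_orthogonal_independent)
  then have "dim (level_space q) = card (?f ` range q)"
    unfolding level_space_eq_span by (simp add: dim_eq_card_independent)
  also have "inj_on ?f (range q)"
  proof (rule inj_onI)
    fix i j assume "i \<in> range q" and eq: "?f i = ?f j"
    then obtain v where "q v = i" by auto
    then have "?f i $ v = 1" by simp
    then show "i = j" using eq \<open>q v = i\<close> by (auto split: if_splits)
  qed
  then have "card (?f ` range q) = card (range q)" by (rule card_image)
  finally show ?thesis .
qed

section \<open>Sums of eigenspaces for roots of unity\<close>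

lemma omega_power: "omega s k ^ j = omega s (k * j)"
  by (simp add: omega_def exp_of_nat_mult[symmetric] mult_ac)

lemma omega_eq_1_iff: "s > 0 \<Longrightarrow> omega s k = 1 \<longleftrightarrow> s dvd k"
  using complex_root_unity_eq_1[of s k] by (simp add: omega_def)

lemma omega_neq_0 [simp]: "omega s k \<noteq> 0"
  by (simp add: omega_def)

lemma omega_mult_cancel: "d > 0 \<Longrightarrow> omega (s * d) (k * d) = omega s k"
  by (simp add: omega_def field_simps)

lemma sum_omega_powers:
  assumes "s > 0"
  shows "(\<Sum>k<s. inverse (omega s j) ^ k) = (if s dvd j then of_nat s else 0)"
proof (cases "s dvd j")
  case False
  then have "inverse (omega s j) \<noteq> 1" using omega_eq_1_iff[OF assms, of j] by simp
  moreover have "inverse (omega s j) ^ s = 1"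
    using omega_eq_1_iff[OF assms, of "j * s"] by (simp add: power_inverse omega_power)
  ultimately show ?thesis using False by (simp add: geometric_sum)
qed (use omega_eq_1_iff[OF assms, of j] in simp)

lemma sum_shift_periodic:
  fixes g :: "nat \<Rightarrow> 'a::comm_monoid_add"
  assumes "g s = g 0"
  shows "(\<Sum>j<s. g (Suc j)) = (\<Sum>j<s. g j)"
proof (cases s)
  case (Suc s')
  then show ?thesis
    using assms sum.lessThan_Suc_shift[of g s'] by (simp add: add.commute)
qed simp

text \<open>
  This is the discrete Fourier expansion along the orbits of \<open>p\<close>: a function with \<open>x \<circ> p\<^sup>s = x\<close> is the
  sum of its components \<open>1/s \<cdot> \<Sum>j<s. \<omega>\<^sup>-\<^sup>j x \<circ> p\<^sup>j\<close> over the \<open>s\<close>-th roots of unity \<open>\<omega>\<close>, and the component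
  of \<open>\<omega>\<close> is an eigenvector because shifting the sum by one permutes its terms cyclically.
\<close>

lemma sum_eigenspaces_omega:
  fixes M :: "complex ^ 'n ^ 'n::finite"
  assumes M: "\<And>x v. (M *v x) $ v = x $ p v" and s: "s > 0"
  shows "(\<Sum>k<s. eigenspace M (omega s k)) = {x. \<forall>v. x $ (p ^^ s) v = x $ v}"
proof (intro equalityI subsetI)
  fix x assume "x \<in> (\<Sum>k<s. eigenspace M (omega s k))"
  then obtain f where f: "x = sum f {..<s}" "\<And>k. k < s \<Longrightarrow> f k \<in> eigenspace M (omega s k)"
    by (auto simp: set_sum_alt)
  have "f k $ (p ^^ j) v = omega s k ^ j * f k $ v" if "k < s" for k j v
  proof (induction j arbitrary: v)
    case (Suc j)
    have "f k $ p w = omega s k * f k $ w" for w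
      using f(2)[OF that] M[of "f k" w] by (simp add: eigenspace_def)
    then show ?case using Suc by simp
  qed simp
  moreover have "omega s k ^ s = 1" for k
    using s omega_eq_1_iff[of s "k * s"] by (simp add: omega_power)
  ultimately show "x \<in> {x. \<forall>v. x $ (p ^^ s) v = x $ v}" by (simp add: f(1))
next
  fix x :: "complex ^ 'n" assume "x \<in> {x. \<forall>v. x $ (p ^^ s) v = x $ v}"
  then have per: "x $ (p ^^ s) v = x $ v" for v by simp
  define f where
    "f k = (\<chi> v. (\<Sum>j<s. inverse (omega s k) ^ j * x $ (p ^^ j) v) / of_nat s)" for k
  have "x = sum f {..<s}"
  proof (subst vec_eq_iff, rule allI)
    fix v
    have inv: "inverse (omega s k) ^ j = inverse (omega s j) ^ k" for j k
      by (simp add: power_inverse omega_power mult.commute)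
    have "sum f {..<s} $ v = (\<Sum>k<s. \<Sum>j<s. inverse (omega s k) ^ j * x $ (p ^^ j) v) / of_nat s"
      by (simp add: f_def sum_divide_distrib)
    also have "(\<Sum>k<s. \<Sum>j<s. inverse (omega s k) ^ j * x $ (p ^^ j) v)
        = (\<Sum>j<s. (\<Sum>k<s. inverse (omega s j) ^ k) * x $ (p ^^ j) v)"
      by (subst sum.swap) (simp add: inv sum_distrib_right)
    also have "\<dots> = (\<Sum>j<s. if j = 0 then of_nat s * x $ v else 0)"
      by (intro sum.cong) (auto simp: sum_omega_powers[OF s] dest: dvd_imp_le)
    also have "\<dots> = of_nat s * x $ v" using s by simp
    finally show "x $ v = sum f {..<s} $ v" using s by simp
  qed
  moreover have "f k \<in> eigenspace M (omega s k)" for k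
  proof -
    have "(M *v f k) $ v = (omega s k *s f k) $ v" for v
    proof -
      define g where "g j = omega s k * (inverse (omega s k) ^ j * x $ (p ^^ j) v)" for j
      have "inverse (omega s k) ^ s = 1"
        using s omega_eq_1_iff[of s "k * s"] by (simp add: power_inverse omega_power)
      then have "g s = g 0" by (simp add: g_def per)
      have "(M *v f k) $ v = (\<Sum>j<s. g (Suc j)) / of_nat s"
        by (simp add: M f_def g_def funpow_swap1 mult.assoc[symmetric])
      also have "\<dots> = (\<Sum>j<s. g j) / of_nat s" by (simp only: sum_shift_periodic[of g, OF \<open>g s = g 0\<close>])
      also have "\<dots> = (omega s k *s f k) $ v" by (simp add: f_def g_def sum_distrib_left)
      finally show ?thesis .
    qed
    then show ?thesis by (simp add: eigenspace_def vec_eq_iff)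
  qed
  ultimately show "x \<in> (\<Sum>k<s. eigenspace M (omega s k))"
    by (subst set_sum_alt) auto
qed

lemma map_matrix_of_real_mult_nth:
  fixes A :: "real ^ 'n ^ 'n::finite"
  assumes "\<And>x. A *v x = pull p x"
  shows "(map_matrix complex_of_real A *v z) $ v = z $ p v"
proof -
  have entry: "A $ v $ j = (if j = p v then 1 else 0)" for j
  proof -
    have "A $ v $ j = (A *v axis j 1) $ v" by (simp add: matrix_vector_mult_basis column_def)
    also have "\<dots> = axis j 1 $ p v" by (simp add: assms)
    finally show ?thesis by (simp add: axis_def)
  qed
  have "(map_matrix complex_of_real A *v z) $ v = (\<Sum>j\<in>UNIV. complex_of_real (A $ v $ j) * z $ j)"
    by (simp add: matrix_vector_mult_def map_matrix_def)
  also have "\<dots> = (\<Sum>j\<in>UNIV. if j = p v then z $ j else 0)"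
    by (rule sum.cong) (simp_all add: entry)
  finally show ?thesis by simp
qed

definition periodic_space :: "('n \<Rightarrow> 'n) \<Rightarrow> nat \<Rightarrow> (real ^ 'n) set" where
  "periodic_space p s = {x. \<forall>v. x $ (p ^^ s) v = x $ v}"

text \<open>
  Every \<open>d\<close>-th one of the \<open>(s d)\<close>-th roots of unity is an \<open>s\<close>-th root of unity, and all of those
  arise in this way.
\<close>

lemma real_points_sum_E_omega:
  fixes A :: "real ^ 'n ^ 'n::finite"
  assumes A: "\<And>x. A *v x = pull p x" and "s > 0" "d > 0"
  shows "real_points (\<Sum>k<s. E_omega A (s * d) (k * d)) = periodic_space p s"
proof -
  have "E_omega A (s * d) (k * d) = eigenspace (map_matrix complex_of_real A) (omega s k)" for k
    using \<open>d > 0\<close> by (simp add: E_omega_def omega_mult_cancel)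
  then show ?thesis
    using sum_eigenspaces_omega[of "map_matrix complex_of_real A" p s] \<open>s > 0\<close>
      map_matrix_of_real_mult_nth[OF A]
    by (simp add: real_points_def periodic_space_def)
qed

section \<open>Functions that factor through the ring\<close>

lemma periodic_space_mult: "x \<in> periodic_space p s \<Longrightarrow> x $ (p ^^ (s * k)) v = x $ v"
  by (induction k arbitrary: v) (simp_all add: periodic_space_def funpow_add)

lemma funpow_funpow: "(f ^^ i) ((f ^^ j) x) = (f ^^ (i + j)) x"
  by (simp add: funpow_add)

lemma periodic_space_balanced: "periodic_space p s \<in> balanced_subspaces p"
proof -
  have "polydiagonal (periodic_space p s)"
    unfolding polydiagonal_def periodic_space_def
    by (intro exI[of _ "range (\<lambda>v. ((p ^^ s) v, v))"]) auto
  moreover have "pull p x \<in> periodic_space p s" if "x \<in> periodic_space p s" for x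
    using that by (simp add: periodic_space_def funpow_swap1)
  ultimately show ?thesis by (simp add: balanced_subspaces_def)
qed

lemma balanced_pull_funpow: "W \<in> balanced_subspaces p \<Longrightarrow> x \<in> W \<Longrightarrow> (pull p ^^ k) x \<in> W"
  by (induction k) (auto simp: balanced_subspaces_def)

text \<open>
  The input function of a connected network with one input per cell, whose ring has \<open>m\<close> cells:
  iterating \<open>p\<close> walks against the arrows, from every cell up its tree and then around the ring. The
  base point \<open>r\<close> is an arbitrary cell of the ring.
\<close>

locale cycle_with_trees =
  fixes p :: "'n::finite \<Rightarrow> 'n" and r :: 'n and m :: nat
  assumes m_pos: "m > 0"
    and cycle: "(p ^^ m) r = r"
    and period: "(p ^^ k) r = r \<Longrightarrow> m dvd k"
    and reaches: "\<exists>k. (p ^^ k) v = r"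
begin

text \<open>
  The distance to the base point. Only its residue modulo \<open>m\<close> matters: it lays the trees along the ring,
  so that every cell takes the position of the ring cell that it copies in a periodic state.
\<close>

definition phase :: "'n \<Rightarrow> nat" where
  "phase v = (LEAST k. (p ^^ k) v = r)"

lemma funpow_phase: "(p ^^ phase v) v = r"
  unfolding phase_def using reaches by (rule LeastI_ex)

lemma phase_unique:
  assumes "(p ^^ k) v = r"
  shows "[k = phase v] (mod m)"
proof -
  have "phase v \<le> k" unfolding phase_def using assms by (rule Least_le)
  then obtain i where k: "k = i + phase v" using le_Suc_ex by (metis add.commute)
  then have "(p ^^ i) r = r" using assms by (simp add: funpow_add funpow_phase)
  then have "m dvd i" by (rule period)
  then show ?thesis unfolding k by (auto simp: cong_def)
qed

lemma phase_funpow: "[phase ((p ^^ i) v) + i = phase v] (mod m)"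
  using phase_unique[of "phase ((p ^^ i) v) + i" v] by (simp add: funpow_add funpow_phase)

lemma phase_root: "phase r = 0"
  unfolding phase_def by (rule Least_equality) auto

text \<open>
  In one direction, \<open>p\<^sup>s\<close> does not change the phase modulo \<open>s\<close>. In the other one, two cells whose phases
  agree modulo \<open>s\<close> are brought to the same ring cell by suitable multiples of \<open>s\<close> as exponents.
\<close>

lemma periodic_space_eq_level_space:
  assumes s: "s dvd m"
  shows "periodic_space p s = level_space (\<lambda>v. phase v mod s)"
proof (intro equalityI subsetI)
  fix x assume x: "x \<in> level_space (\<lambda>v. phase v mod s)"
  have "x $ (p ^^ s) v = x $ v" for v
  proof -
    have "[phase ((p ^^ s) v) + s = phase v] (mod s)"
      using phase_funpow s by (rule cong_dvd_modulus_nat)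
    then have "phase ((p ^^ s) v) mod s = phase v mod s" by (simp add: cong_def)
    then show ?thesis using x unfolding level_space_def by blast
  qed
  then show "x \<in> periodic_space p s" by (simp add: periodic_space_def)
next
  fix x assume x: "x \<in> periodic_space p s"
  have eq: "x $ u = x $ v" if "phase u mod s = phase v mod s" "phase u \<le> phase v" for u v
  proof -
    have "s dvd phase v - phase u" using that by (simp add: mod_eq_dvd_iff_nat[symmetric])
    then obtain j where "phase v - phase u = s * j" by (elim dvdE)
    then have j: "phase v = phase u + s * j" using that by simp
    obtain s' where s': "s = Suc s'" using s m_pos by (cases s) auto
    have "(p ^^ (s * phase u)) u = (p ^^ (s' * phase u)) ((p ^^ phase u) u)"
      by (simp add: s' funpow_funpow add.commute)
    also have "\<dots> = (p ^^ (s' * phase u)) ((p ^^ phase v) v)" by (simp add: funpow_phase)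
    also have "\<dots> = (p ^^ (s * (phase u + j))) v"
      by (simp add: j s' funpow_funpow algebra_simps)
    finally show ?thesis using periodic_space_mult[OF x] by metis
  qed
  have "x $ u = x $ v" if "phase u mod s = phase v mod s" for u v
    using eq[of u v] eq[of v u] that by (metis nle_le)
  then show "x \<in> level_space (\<lambda>v. phase v mod s)" unfolding level_space_def by blast
qed

lemma dim_periodic_space:
  assumes s: "s dvd m"
  shows "dim (periodic_space p s) = s"
proof -
  have "s > 0" "s \<le> m" using s m_pos dvd_pos_nat dvd_imp_le by blast+
  have "i \<in> range (\<lambda>v. phase v mod s)" if "i < s" for i
  proof
    have "(p ^^ i) ((p ^^ (m - i)) r) = (p ^^ (i + (m - i))) r" by (simp add: funpow_add)
    then have "(p ^^ i) ((p ^^ (m - i)) r) = r" using that \<open>s \<le> m\<close> cycle by simp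
    then have "[i = phase ((p ^^ (m - i)) r)] (mod s)"
      using phase_unique s cong_dvd_modulus_nat by blast
    then show "i = phase ((p ^^ (m - i)) r) mod s" using that by (simp add: cong_def)
  qed simp
  then have "range (\<lambda>v. phase v mod s) = {..<s}" using \<open>s > 0\<close> by auto
  then show ?thesis by (simp add: periodic_space_eq_level_space[OF s] dim_level_space)
qed

text \<open>
  A proper subspace equates two cells \<open>u\<close> and \<open>v\<close> of different phases modulo \<open>s\<close>. Invariance moves this
  equality along the whole ring, and so the difference \<open>a\<close> of the phases becomes a period of all
  its elements.
\<close>

lemma proper_subspace_of_periodic_space:
  assumes s: "s dvd m" and X: "X \<in> balanced_subspaces p" and sub: "X \<subset> periodic_space p s"
  obtains a where "0 < a" "a < s" "X \<subseteq> periodic_space p a"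
proof -
  have "s > 0" using s m_pos dvd_pos_nat by blast
  have poly: "polydiagonal X" using X by (simp add: balanced_subspaces_def)
  obtain z where z: "z \<in> periodic_space p s" "z \<notin> X" using sub by blast
  obtain u v where uv: "\<forall>y\<in>X. y $ u = y $ v" "z $ u \<noteq> z $ v"
    using z(2) polydiagonal_kernel[OF poly, of z] by blast
  have "phase u mod s \<noteq> phase v mod s"
    using uv(2) z(1) unfolding periodic_space_eq_level_space[OF s] level_space_def by blast
  then obtain u v where uv: "\<forall>y\<in>X. y $ u = y $ v" and less: "phase u mod s < phase v mod s"
    using uv by (metis nat_neq_iff)
  define a where "a = phase v mod s - phase u mod s"
  have a: "0 < a" "a < s" using less \<open>s > 0\<close> by (auto simp: a_def less_imp_diff_less)
  have "[phase ((p ^^ a) v) + a = phase v] (mod s)"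
    using phase_funpow s by (rule cong_dvd_modulus_nat)
  moreover have "[phase u + a = phase v] (mod s)"
  proof -
    have "(phase u + a) mod s = (phase u mod s + a) mod s" by (simp add: mod_simps)
    then show ?thesis using less by (simp add: a_def cong_def)
  qed
  ultimately have "[phase ((p ^^ a) v) + a = phase u + a] (mod s)"
    using cong_sym cong_trans by blast
  then have same: "phase ((p ^^ a) v) mod s = phase u mod s"
    by (simp only: cong_add_rcancel_nat) (simp add: cong_def)
  have "x $ (p ^^ a) w = x $ w" if x: "x \<in> X" for x w
  proof -
    obtain s' where s': "s = Suc s'" using \<open>s > 0\<close> by (cases s) auto
    \<comment> \<open>Chosen such that \<open>p\<^sup>k v\<close> lies on the ring and has the phase of \<open>w\<close> modulo \<open>s\<close>.\<close>
    define k where "k = s' * phase w + phase v"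
    have kv: "(p ^^ k) v = (p ^^ (s * phase w)) w"
    proof -
      have "(p ^^ k) v = (p ^^ (s' * phase w)) ((p ^^ phase w) w)"
        by (simp add: k_def funpow_add funpow_phase)
      also have "\<dots> = (p ^^ (s * phase w)) w"
        by (simp add: s' funpow_funpow add.commute)
      finally show ?thesis .
    qed
    have xs: "x \<in> periodic_space p s" using x sub by blast
    define y where "y = (pull p ^^ k) x"
    have "y \<in> X" using balanced_pull_funpow[OF X x] by (simp add: y_def)
    then have "y \<in> level_space (\<lambda>v. phase v mod s)"
      using sub by (auto simp: periodic_space_eq_level_space[OF s])
    then have "y $ (p ^^ a) v = y $ u"
      using same by (rule level_spaceD)
    moreover have "y $ u = y $ v" using bspec[OF uv(1) \<open>y \<in> X\<close>] .
    moreover have "y $ v = x $ w"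
      by (simp add: y_def kv periodic_space_mult[OF xs])
    moreover have "y $ (p ^^ a) v = x $ (p ^^ a) w"
    proof -
      have "(p ^^ k) ((p ^^ a) v) = (p ^^ a) ((p ^^ k) v)"
        by (simp add: funpow_funpow add.commute)
      also have "\<dots> = (p ^^ (s * phase w)) ((p ^^ a) w)"
        unfolding kv by (simp add: funpow_funpow add.commute)
      finally show ?thesis by (simp add: y_def periodic_space_mult[OF xs])
    qed
    ultimately show ?thesis by simp
  qed
  then have "X \<subseteq> periodic_space p a" by (auto simp: periodic_space_def)
  then show ?thesis using that a by blast
qed

text \<open>
  If \<open>a\<close> and \<open>b\<close> are periods of the two summands, then \<open>z(a + b) - z(a) - z(b) + z(0) = 0\<close> for every \<open>z\<close> in
  the sum, where \<open>z(j)\<close> is the value at \<open>p\<^sup>j r\<close>. The indicator of the phase zero violates this, since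
  \<open>a\<close> and \<open>b\<close> are not multiples of \<open>s\<close>.
\<close>

lemma join_irreducible_periodic_space:
  assumes s: "s dvd m"
  shows "join_irreducible (balanced_subspaces p) (periodic_space p s)"
  unfolding join_irreducible_def
proof (intro conjI notI periodic_space_balanced, elim bexE conjE)
  fix X Y assume X: "X \<in> balanced_subspaces p" "X \<noteq> periodic_space p s"
    and Y: "Y \<in> balanced_subspaces p" "Y \<noteq> periodic_space p s"
    and sum: "periodic_space p s = X + Y"
  obtain a where a: "0 < a" "a < s" "X \<subseteq> periodic_space p a"
    using proper_subspace_of_periodic_space[OF s X(1)] X Y balanced_summands[of X p Y] sum by blast
  obtain b where b: "0 < b" "b < s" "Y \<subseteq> periodic_space p b"
    using proper_subspace_of_periodic_space[OF s Y(1)] X Y balanced_summands[of X p Y] sum by blast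
  define z where "z = indicator_vec {v. phase v mod s = 0}"
  have "z \<in> periodic_space p s"
    unfolding periodic_space_eq_level_space[OF s] by (simp add: level_space_def z_def)
  then obtain x y where xy: "x \<in> X" "y \<in> Y" "z = x + y" unfolding sum by (auto elim: set_plus_elim)
  have "x $ (p ^^ (a + b)) r = x $ (p ^^ b) r" "x $ (p ^^ a) r = x $ r"
    using xy(1) a(3) by (auto simp: periodic_space_def funpow_add)
  moreover have "y $ (p ^^ (a + b)) r = y $ (p ^^ a) r" "y $ (p ^^ b) r = y $ r"
    using xy(2) b(3) by (auto simp: periodic_space_def funpow_add add.commute[of a b])
  ultimately have "z $ (p ^^ (a + b)) r + z $ r = z $ (p ^^ a) r + z $ (p ^^ b) r"
    by (simp add: xy(3))
  moreover have "z $ (p ^^ c) r = 0" if "0 < c" "c < s" for c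
  proof -
    have "[phase ((p ^^ c) r) + c = 0] (mod s)"
      using phase_funpow[of c r] s cong_dvd_modulus_nat by (metis phase_root)
    then have "s dvd phase ((p ^^ c) r) + c" by (simp add: cong_0_iff)
    then have "\<not> s dvd phase ((p ^^ c) r)"
      using that by (metis dvd_add_right_iff nat_dvd_not_less)
    then show ?thesis by (simp add: z_def mod_eq_0_iff_dvd)
  qed
  moreover have "z $ r = 1" by (simp add: z_def phase_root)
  moreover have "z $ (p ^^ (a + b)) r \<ge> 0" by (simp add: z_def)
  ultimately show False using a b by simp
qed

text \<open>
  The least period \<open>s\<close> that is common to all elements of \<open>W\<close> divides \<open>m\<close> by division with remainder. If
  \<open>W\<close> were a proper subspace of the functions of period \<open>s\<close>, it would have a smaller period.
\<close>

lemma balanced_subspace_of_periodic_space: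
  assumes W: "W \<in> balanced_subspaces p" and sub: "W \<subseteq> periodic_space p m"
  obtains s where "s dvd m" "W = periodic_space p s"
proof -
  define s where "s = (LEAST k. 0 < k \<and> W \<subseteq> periodic_space p k)"
  have s: "0 < s \<and> W \<subseteq> periodic_space p s"
    unfolding s_def by (rule LeastI[of _ m]) (use m_pos sub in simp)
  have least: "s \<le> k" if "0 < k" "W \<subseteq> periodic_space p k" for k
    unfolding s_def using that by (simp add: Least_le)
  have "x $ (p ^^ (m mod s)) v = x $ v" if "x \<in> W" for x v
  proof -
    have x: "x \<in> periodic_space p s" "x \<in> periodic_space p m" using that s sub by auto
    have "x $ v = x $ (p ^^ (s * (m div s) + m mod s)) v" using x(2) by (simp add: periodic_space_def)
    also have "\<dots> = x $ (p ^^ (m mod s)) v"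
      by (simp only: funpow_add comp_apply periodic_space_mult[OF x(1)])
    finally show ?thesis by simp
  qed
  then have "W \<subseteq> periodic_space p (m mod s)" by (auto simp: periodic_space_def)
  then have "s dvd m" using least[of "m mod s"] s by (meson mod_greater_zero_iff_not_dvd mod_less_divisor not_less)
  moreover have "W = periodic_space p s"
  proof (rule ccontr)
    assume "W \<noteq> periodic_space p s"
    then obtain a where "0 < a" "a < s" "W \<subseteq> periodic_space p a"
      using proper_subspace_of_periodic_space[OF \<open>s dvd m\<close> W] s by blast
    then show False using least[of a] by simp
  qed
  ultimately show ?thesis using that by blast
qed

end

section \<open>Irreducible subspaces that are constant on the ring\<close>

lemma join_irreducibleD:
  "\<lbrakk>join_irreducible V W; X \<in> V; Y \<in> V; W = X + Y\<rbrakk> \<Longrightarrow> X = W \<or> Y = W"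
  unfolding join_irreducible_def by blast

lemma balanced_Int:
  assumes "W \<in> balanced_subspaces p" "W' \<in> balanced_subspaces p"
  shows "W \<inter> W' \<in> balanced_subspaces p"
proof -
  obtain R R' where "W = {x. \<forall>(u, v)\<in>R. x $ u = x $ v}" "W' = {x. \<forall>(u, v)\<in>R'. x $ u = x $ v}"
    using assms unfolding balanced_subspaces_def polydiagonal_def by blast
  then have "W \<inter> W' = {x. \<forall>(u, v)\<in>R \<union> R'. x $ u = x $ v}" by blast
  then have "polydiagonal (W \<inter> W')" unfolding polydiagonal_def by blast
  then show ?thesis using assms by (simp add: balanced_subspaces_def)
qed

definition synchronous :: "(real ^ 'n) set \<Rightarrow> 'n \<Rightarrow> 'n \<Rightarrow> bool" where
  "synchronous W u v \<longleftrightarrow> (\<forall>x\<in>W. x $ u = x $ v)"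

lemma synchronousD: "\<lbrakk>synchronous W u v; x \<in> W\<rbrakk> \<Longrightarrow> x $ u = x $ v"
  by (simp add: synchronous_def)

lemma synchronous_refl: "synchronous W u u"
  by (simp add: synchronous_def)

lemma synchronous_sym: "synchronous W u v \<Longrightarrow> synchronous W v u"
  unfolding synchronous_def by metis

lemma synchronous_trans: "\<lbrakk>synchronous W u v; synchronous W v w\<rbrakk> \<Longrightarrow> synchronous W u w"
  unfolding synchronous_def by metis

lemma mem_iff_synchronous:
  "polydiagonal W \<Longrightarrow> x \<in> W \<longleftrightarrow> (\<forall>u v. synchronous W u v \<longrightarrow> x $ u = x $ v)"
  unfolding synchronous_def by (rule polydiagonal_kernel)

lemma synchronous_step:
  assumes "W \<in> balanced_subspaces p" and "synchronous W u v"
  shows "synchronous W (p u) (p v)"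
  unfolding synchronous_def
proof
  fix x assume "x \<in> W"
  then have "pull p x \<in> W" using assms(1) by (simp add: balanced_subspaces_def)
  then show "x $ p u = x $ p v" using synchronousD[OF assms(2)] by fastforce
qed

lemma synchronous_funpow:
  assumes "W \<in> balanced_subspaces p" and "synchronous W u v"
  shows "synchronous W ((p ^^ k) u) ((p ^^ k) v)"
  by (induction k) (simp_all add: assms synchronous_step)

text \<open>
  Two classes of synchronous cells that could be merged without merging any others: the atoms among
  the coarsenings of the synchrony relation, apart from those that
  identify ring cells with each other. The class of the
  ring is its own input when \<open>W\<close> is constant on the ring, so it forms such pairs with its children.
\<close>

definition critical_pair :: "('n \<Rightarrow> 'n) \<Rightarrow> (real ^ 'n) set \<Rightarrow> 'n \<Rightarrow> 'n \<Rightarrow> bool" where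
  "critical_pair p W a b \<longleftrightarrow> \<not> synchronous W a b \<and> synchronous W (p a) (p b)"

lemma balanced_identify_critical_pair:
  assumes W: "W \<in> balanced_subspaces p" and ab: "critical_pair p W a b"
  shows "{x \<in> W. x $ a = x $ b} \<in> balanced_subspaces p" "{x \<in> W. x $ a = x $ b} \<noteq> W"
proof -
  obtain R where "W = {x. \<forall>(u, v)\<in>R. x $ u = x $ v}"
    using W unfolding balanced_subspaces_def polydiagonal_def by blast
  then have "{x \<in> W. x $ a = x $ b} = {x. \<forall>(u, v)\<in>insert (a, b) R. x $ u = x $ v}" by blast
  then have "polydiagonal {x \<in> W. x $ a = x $ b}" unfolding polydiagonal_def by blast
  moreover have "x $ p a = x $ p b" if "x \<in> W" for x
    using ab that synchronousD unfolding critical_pair_def by blast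
  ultimately show "{x \<in> W. x $ a = x $ b} \<in> balanced_subspaces p"
    using W by (simp add: balanced_subspaces_def)
  show "{x \<in> W. x $ a = x $ b} \<noteq> W"
    using ab unfolding critical_pair_def synchronous_def by blast
qed

text \<open>
  Merging a critical pair cuts out a hyperplane of \<open>W\<close>, and distinct hyperplanes sum up to \<open>W\<close>. The
  indicator \<open>z\<close> of the class of \<open>c\<close> is the transversal direction: it lies in the hyperplane of \<open>(a, b)\<close>, as
  neither \<open>a\<close> nor \<open>b\<close> is in this class, and takes different values at \<open>c\<close> and \<open>d\<close>.
\<close>

lemma critical_pair_unique:
  assumes irr: "join_irreducible (balanced_subspaces p) W"
    and ab: "critical_pair p W a b" and cd: "critical_pair p W c d"
  shows "synchronous W c a \<or> synchronous W c b"
proof (rule ccontr)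
  assume no: "\<not> ?thesis"
  let ?X = "{x \<in> W. x $ a = x $ b}" and ?Y = "{x \<in> W. x $ c = x $ d}"
  have W: "W \<in> balanced_subspaces p" using irr by (simp add: join_irreducible_def)
  then have poly: "polydiagonal W" and sub: "subspace W"
    using balanced_subspace by (auto simp: balanced_subspaces_def)
  define z where "z = indicator_vec {v. synchronous W v c}"
  have "z \<in> W"
    unfolding mem_iff_synchronous[OF poly] z_def
    using synchronous_sym synchronous_trans by (metis indicator_vec_nth mem_Collect_eq)
  moreover have "z $ a = 0" "z $ b = 0" using no synchronous_sym by (auto simp: z_def)
  moreover have zcd: "z $ c = 1" "z $ d = 0"
    using cd synchronous_sym synchronous_refl by (auto simp: z_def critical_pair_def)
  ultimately have zX: "t *\<^sub>R z \<in> ?X" for t using sub by (simp add: subspace_scale)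
  have "W = ?X + ?Y"
  proof (intro equalityI subsetI)
    fix x assume "x \<in> W"
    have "x - (x $ c - x $ d) *\<^sub>R z \<in> ?Y"
      using zcd sub \<open>x \<in> W\<close> \<open>z \<in> W\<close> by (simp add: subspace_diff subspace_scale)
    from set_plus_intro[OF zX[of "x $ c - x $ d"] this] show "x \<in> ?X + ?Y" by simp
  next
    fix x assume "x \<in> ?X + ?Y"
    then obtain y1 y2 where "x = y1 + y2" "y1 \<in> W" "y2 \<in> W" by (rule set_plus_elim) simp
    then show "x \<in> W" using sub by (simp add: subspace_add)
  qed
  then have "?X = W \<or> ?Y = W"
    by (rule join_irreducibleD[OF irr balanced_identify_critical_pair(1)[OF W ab]
          balanced_identify_critical_pair(1)[OF W cd]])
  then show False
    by (elim disjE) (rule notE[OF balanced_identify_critical_pair(2)[OF W ab]], assumption,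
      rule notE[OF balanced_identify_critical_pair(2)[OF W cd]])
qed

context cycle_with_trees
begin

definition ring_constant :: "(real ^ 'n) set" where
  "ring_constant = {x. \<forall>k. x $ (p ^^ k) r = x $ r}"

lemma ring_constant_balanced: "ring_constant \<in> balanced_subspaces p"
proof -
  have "polydiagonal ring_constant"
    unfolding polydiagonal_def ring_constant_def
    by (intro exI[of _ "range (\<lambda>k. ((p ^^ k) r, r))"]) auto
  moreover have "pull p x \<in> ring_constant" if "x \<in> ring_constant" for x
  proof -
    have x: "x $ (p ^^ k) r = x $ r" for k using that by (simp add: ring_constant_def)
    have "x $ p ((p ^^ k) r) = x $ r" for k using x[of "Suc k"] by simp
    then show ?thesis using x[of 1] by (simp add: ring_constant_def)
  qed
  ultimately show ?thesis by (simp add: balanced_subspaces_def)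
qed

lemma funpow_mult_root: "(p ^^ (m * k)) r = r"
  by (induction k) (simp_all add: funpow_add cycle)

text \<open>
  For a multiple of \<open>m\<close> that is large enough for the power of \<open>p\<close> to map all cells into the ring, \<open>y\<close> is the
  periodic function that agrees with \<open>x\<close> on the ring, and \<open>x - y\<close> vanishes on the ring.
\<close>

lemma split_periodic_ring_constant:
  assumes W: "W \<in> balanced_subspaces p"
  shows "W = (W \<inter> periodic_space p m) + (W \<inter> ring_constant)"
proof (intro equalityI subsetI)
  fix x assume "x \<in> (W \<inter> periodic_space p m) + (W \<inter> ring_constant)"
  then show "x \<in> W"
    using balanced_subspace[OF W] by (auto elim!: set_plus_elim intro: subspace_add)
next
  fix x assume x: "x \<in> W"
  \<comment> \<open>A crude common bound for all phases.\<close>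
  define N where "N = (\<Sum>v\<in>UNIV. phase v)"
  define y where "y = (pull p ^^ (m * N)) x"
  have "y \<in> W" using balanced_pull_funpow[OF W x] by (simp add: y_def)
  have "y $ (p ^^ m) v = y $ v" for v
  proof -
    have "phase v \<le> N" unfolding N_def by (rule member_le_sum) auto
    also have "N \<le> m * N" using m_pos by simp
    finally obtain i where i: "m * N = i + phase v" using le_Suc_ex by (metis add.commute)
    have v: "(p ^^ (m * N)) v = (p ^^ i) r" by (simp add: i funpow_add funpow_phase)
    have "(p ^^ (m * N)) ((p ^^ m) v) = (p ^^ m) ((p ^^ (m * N)) v)"
      by (simp only: funpow_funpow add.commute)
    also have "\<dots> = (p ^^ i) ((p ^^ m) r)"
      unfolding v by (simp only: funpow_funpow add.commute)
    finally have "(p ^^ (m * N)) ((p ^^ m) v) = (p ^^ (m * N)) v" by (simp add: cycle v)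
    then show ?thesis by (simp add: y_def)
  qed
  then have "y \<in> periodic_space p m" by (simp add: periodic_space_def)
  moreover have "x - y \<in> ring_constant"
  proof -
    have "(p ^^ (m * N)) ((p ^^ k) r) = (p ^^ k) ((p ^^ (m * N)) r)" for k
      by (simp only: funpow_funpow add.commute)
    then have "(x - y) $ (p ^^ k) r = 0" for k by (simp add: y_def funpow_mult_root)
    from this this[of 0] show ?thesis by (simp add: ring_constant_def)
  qed
  moreover have "x - y \<in> W" using balanced_subspace[OF W] x \<open>y \<in> W\<close> by (rule subspace_diff)
  ultimately have "y + (x - y) \<in> (W \<inter> periodic_space p m) + (W \<inter> ring_constant)"
    using \<open>y \<in> W\<close> by (intro set_plus_intro) auto
  then show "x \<in> (W \<inter> periodic_space p m) + (W \<inter> ring_constant)" by simp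
qed

lemma join_irreducible_periodic_or_ring_constant:
  assumes irr: "join_irreducible (balanced_subspaces p) W"
  shows "W \<subseteq> periodic_space p m \<or> W \<subseteq> ring_constant"
proof -
  have W: "W \<in> balanced_subspaces p" using irr by (simp add: join_irreducible_def)
  note balanced_Int[OF W periodic_space_balanced[of p m]] balanced_Int[OF W ring_constant_balanced]
  from join_irreducibleD[OF irr this split_periodic_ring_constant[OF W]]
  show ?thesis by blast
qed

text \<open>
  The depth of a cell is its distance to the class of the ring in the quotient by synchrony. As there is only
  one critical pair, and the class of the ring belongs to it, no two classes outside the
  ring have the same input. By induction on the depth, cells of equal depth are synchronous; the
  quotient is a path, and \<open>W\<close> consists of the functions of the depth. The chain is
  generated by the indicator of depth one, because \<open>pull p\<close> shifts the depth by one.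
\<close>

lemma join_irreducible_ring_constant_krylov:
  assumes irr: "join_irreducible (balanced_subspaces p) W"
    and const: "W \<subseteq> ring_constant" and nonper: "\<not> W \<subseteq> periodic_space p m"
  obtains k S where "(pull p ^^ k) (indicator_vec S) \<noteq> 0"
    "(pull p ^^ Suc k) (indicator_vec S) = 0"
    "W = span (insert 1 (krylov (pull p) k (indicator_vec S)))"
proof -
  have W: "W \<in> balanced_subspaces p" using irr by (simp add: join_irreducible_def)
  then have poly: "polydiagonal W" by (simp add: balanced_subspaces_def)
  note sym = synchronous_sym[of W] and trans = synchronous_trans[of W]
    and step = synchronous_step[OF W]
  have "synchronous W (p r) r"
    unfolding synchronous_def
  proof
    fix x assume "x \<in> W"
    then have "\<forall>k. x $ (p ^^ k) r = x $ r" using const by (auto simp: ring_constant_def)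
    from spec[OF this, of 1] show "x $ p r = x $ r" by simp
  qed
  then have step_root: "synchronous W (p v) r" if "synchronous W v r" for v
    using trans step[OF that] by blast

  define depth where "depth v = (LEAST j. synchronous W ((p ^^ j) v) r)" for v
  have "\<exists>j. synchronous W ((p ^^ j) v) r" for v
    using reaches synchronous_refl by metis
  then have depth: "synchronous W ((p ^^ depth v) v) r" for v
    unfolding depth_def by (rule LeastI_ex)
  have depth_le: "depth v \<le> j" if "synchronous W ((p ^^ j) v) r" for v j
    unfolding depth_def using that by (rule Least_le)
  have depth_0: "depth v = 0 \<longleftrightarrow> synchronous W v r" for v
    using depth[of v] depth_le[of 0 v] by auto
  have depth_step: "depth (p v) = depth v - 1" for v
  proof (cases "depth v")
    case 0
    then show ?thesis using depth_0[of v] depth_0[of "p v"] step_root[of v] by simp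
  next
    case (Suc d)
    have "depth (p v) \<le> d"
      using depth[of v] by (intro depth_le) (simp add: Suc funpow_swap1)
    moreover have "depth v \<le> Suc (depth (p v))"
      using depth[of "p v"] by (intro depth_le) (simp add: funpow_swap1)
    ultimately show ?thesis using Suc by simp
  qed
  have depth_funpow: "depth ((p ^^ j) v) = depth v - j" for j v
    by (induction j) (simp_all add: depth_step)

  \<comment> \<open>A cell outside the class of the ring exists, as otherwise \<open>W\<close> would consist of constant functions.\<close>
  obtain v0 where v0: "\<not> synchronous W v0 r"
  proof (rule ccontr)
    assume "\<not> thesis"
    then have all: "synchronous W v r" for v using that by blast
    have "x $ u = x $ v" if "x \<in> W" for x u v
      using synchronousD[OF trans[OF all sym[OF all]] that] .
    then have "W \<subseteq> periodic_space p m" unfolding periodic_space_def by blast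
    then show False using nonper by blast
  qed
  obtain d0 where d0: "depth v0 = Suc d0" using v0 depth_0[of v0] by (cases "depth v0") auto
  define a where "a = (p ^^ d0) v0"
  have "depth a = 1" by (simp add: a_def depth_funpow d0)
  then have "critical_pair p W a r"
    using depth_0[of a] depth_0[of "p a"] depth_step[of a] trans sym \<open>synchronous W (p r) r\<close>
    unfolding critical_pair_def by (metis diff_self_eq_0 zero_neq_one)
  then have at_root: "synchronous W u r \<or> synchronous W v r" if "critical_pair p W u v" for u v
  proof -
    have "critical_pair p W v u" using that sym unfolding critical_pair_def by blast
    then have "synchronous W u a \<or> synchronous W u r" "synchronous W v a \<or> synchronous W v r"
      using critical_pair_unique[OF irr \<open>critical_pair p W a r\<close>] that by blast+
    then show ?thesis using that sym trans unfolding critical_pair_def by blast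
  qed
  have depth_eq: "synchronous W u v" if "depth u = n" "depth v = n" for n u v
    using that
  proof (induction n arbitrary: u v)
    case 0
    then show ?case using depth_0 trans sym by blast
  next
    case (Suc n)
    then have "synchronous W (p u) (p v)" by (simp add: depth_step)
    then show ?case
      using at_root[of u v] Suc.prems depth_0 unfolding critical_pair_def by (metis nat.distinct(1))
  qed
  have eq_depth: "depth u = depth v" if "synchronous W u v" for u v
  proof (rule antisym)
    show "depth u \<le> depth v"
      using depth_le trans synchronous_funpow[OF W that] depth[of v] by blast
    show "depth v \<le> depth u"
      using depth_le trans synchronous_funpow[OF W sym[OF that]] depth[of u] by blast
  qed
  have W_level: "W = level_space depth"
    using mem_iff_synchronous[OF poly] depth_eq eq_depth unfolding level_space_def by blast

  define S where "S = depth -` {1}"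
  \<comment> \<open>The levels below the ring are numbered from one, the vectors of a chain from zero.\<close>
  define k where "k = Max (range depth) - 1"
  have "Max (range depth) \<in> range depth" by (rule Max_in) auto
  then obtain w where w: "Max (range depth) = depth w" by (rule imageE)
  have max_w: "depth v \<le> depth w" for v unfolding w[symmetric] by (rule Max_ge) auto
  have "depth w = Suc k" using max_w[of v0] d0 by (simp add: k_def w)
  then have max: "depth v \<le> Suc k" for v using max_w[of v] by simp
  have power: "(pull p ^^ j) (indicator_vec S) = indicator_vec (depth -` {Suc j})" for j
    by (auto simp: vec_eq_iff S_def depth_funpow)
  let ?B = "insert 1 (krylov (pull p) k (indicator_vec S))"
  have K: "indicator_vec (depth -` {Suc j}) \<in> span ?B" if "j \<le> k" for j
    by (rule span_base) (use that in \<open>auto simp: krylov_def power\<close>)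
  \<comment> \<open>The all-ones vector replaces the indicator of the class of the ring in the basis of level indicators.\<close>
  have "indicator_vec (depth -` {0}) = 1 - (\<Sum>j\<le>k. indicator_vec (depth -` {Suc j}))"
  proof (subst vec_eq_iff, rule allI)
    fix v
    have "(\<Sum>j\<le>k. indicator_vec (depth -` {Suc j}) $ v) = (\<Sum>j\<le>k. if j = depth v - 1 \<and> depth v \<noteq> 0 then 1 else 0)"
      by (rule sum.cong) auto
    also have "\<dots> = (if depth v \<noteq> 0 then 1 else 0)"
      using max[of v] by (cases "depth v = 0") auto
    finally show "indicator_vec (depth -` {0}) $ v = (1 - (\<Sum>j\<le>k. indicator_vec (depth -` {Suc j}))) $ v"
      by simp
  qed
  then have "indicator_vec (depth -` {0}) \<in> span ?B"
    using K by (auto intro!: span_diff span_sum intro: span_base)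
  then have "indicator_vec (depth -` {i}) \<in> span ?B" if "i \<in> range depth" for i
  proof (cases i)
    case (Suc j)
    from \<open>i \<in> range depth\<close> obtain v where "i = depth v" by (rule imageE)
    then show ?thesis using max[of v] Suc K[of j] by simp
  qed simp
  then have "W \<subseteq> span ?B"
    unfolding W_level level_space_eq_span by (intro span_minimal) auto
  moreover have "span ?B \<subseteq> W"
  proof (rule span_minimal)
    have "indicator_vec (depth -` {j}) \<in> W" for j
      unfolding W_level by (simp add: level_space_def)
    then show "?B \<subseteq> W"
      using one_in_polydiagonal[OF poly] by (auto simp: krylov_def power)
  qed (rule balanced_subspace[OF W])
  moreover have "(pull p ^^ k) (indicator_vec S) \<noteq> 0"
    using \<open>depth w = Suc k\<close> unfolding power by auto
  moreover have "(pull p ^^ Suc k) (indicator_vec S) = 0"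
    using max unfolding power by (simp add: vimage_def) (metis Suc_n_not_le_n)
  ultimately show ?thesis using that by blast
qed

theorem join_irreducible_iff:
  "join_irreducible (balanced_subspaces p) W \<longleftrightarrow>
     (\<exists>s. s dvd m \<and> W = periodic_space p s) \<or>
     (\<exists>k S. (pull p ^^ k) (indicator_vec S) \<noteq> 0 \<and> (pull p ^^ Suc k) (indicator_vec S) = 0 \<and>
        W = span (insert 1 (krylov (pull p) k (indicator_vec S))) \<and> W \<in> balanced_subspaces p)"
proof
  assume irr: "join_irreducible (balanced_subspaces p) W"
  then have W: "W \<in> balanced_subspaces p" by (simp add: join_irreducible_def)
  show "(\<exists>s. s dvd m \<and> W = periodic_space p s) \<or>
     (\<exists>k S. (pull p ^^ k) (indicator_vec S) \<noteq> 0 \<and> (pull p ^^ Suc k) (indicator_vec S) = 0 \<and>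
        W = span (insert 1 (krylov (pull p) k (indicator_vec S))) \<and> W \<in> balanced_subspaces p)"
  proof (cases "W \<subseteq> periodic_space p m")
    case True
    then show ?thesis using balanced_subspace_of_periodic_space[OF W] by metis
  next
    case False
    then have "W \<subseteq> ring_constant" using join_irreducible_periodic_or_ring_constant[OF irr] by blast
    then show ?thesis using join_irreducible_ring_constant_krylov[OF irr _ False] W by metis
  qed
next
  assume "(\<exists>s. s dvd m \<and> W = periodic_space p s) \<or>
     (\<exists>k S. (pull p ^^ k) (indicator_vec S) \<noteq> 0 \<and> (pull p ^^ Suc k) (indicator_vec S) = 0 \<and>
        W = span (insert 1 (krylov (pull p) k (indicator_vec S))) \<and> W \<in> balanced_subspaces p)"
  then show "join_irreducible (balanced_subspaces p) W"
    using join_irreducible_periodic_space join_irreducible_krylov by blast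
qed

end

section \<open>Networks as functions on cells\<close>

lemma in_arcs_input_cell:
  assumes "one_input_network G"
  obtains e where "in_arcs G v = {e}" "tail G e = input_cell G v"
proof -
  obtain e where "in_arcs G v = {e}"
    using assms card_1_singletonE unfolding one_input_network_def in_degree_def by metis
  then show ?thesis using that unfolding input_cell_def by auto
qed

lemma input_cell_head:
  assumes "one_input_network G" "e \<in> arcs G"
  shows "input_cell G (head G e) = tail G e"
proof -
  obtain e' where e': "in_arcs G (head G e) = {e'}" "tail G e' = input_cell G (head G e)"
    using in_arcs_input_cell[OF assms(1)] by metis
  moreover have "e \<in> in_arcs G (head G e)" using assms(2) by simp
  ultimately show ?thesis by simp
qed

lemma adjacency_matrix_nth:
  assumes "one_input_network G"
  shows "adjacency_matrix G $ i $ j = (if j = input_cell G i then 1 else 0)"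
proof -
  obtain e where e: "in_arcs G i = {e}" "tail G e = input_cell G i"
    using in_arcs_input_cell[OF assms] by metis
  have "{e \<in> arcs G. tail G e = j \<and> head G e = i} = {e \<in> in_arcs G i. tail G e = j}" by auto
  also have "\<dots> = (if j = input_cell G i then {e} else {})" using e by auto
  finally show ?thesis by (simp add: adjacency_matrix_def)
qed

lemma adjacency_matrix_mult:
  assumes "one_input_network G"
  shows "adjacency_matrix G *v x = pull (input_cell G) x"
proof (subst vec_eq_iff, rule allI)
  fix i
  have "(adjacency_matrix G *v x) $ i = (\<Sum>j\<in>UNIV. if j = input_cell G i then x $ j else 0)"
    unfolding matrix_vector_mult_def vec_lambda_beta
    by (rule sum.cong) (simp_all add: adjacency_matrix_nth[OF assms])
  then show "(adjacency_matrix G *v x) $ i = pull (input_cell G) x $ i" by simp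
qed

lemma arcs_ends_input_cell:
  assumes "one_input_network G"
  shows "(u, v) \<in> arcs_ends G \<longleftrightarrow> u = input_cell G v"
proof
  assume "(u, v) \<in> arcs_ends G"
  then show "u = input_cell G v" using input_cell_head[OF assms] by (auto elim: reachableE)
next
  assume "u = input_cell G v"
  moreover obtain e where "in_arcs G v = {e}" "tail G e = input_cell G v"
    using in_arcs_input_cell[OF assms] by metis
  ultimately show "(u, v) \<in> arcs_ends G" unfolding arcs_ends_conv
    by (intro image_eqI[of _ _ e]) (auto simp: set_eq_iff)
qed

lemma ring_cells_funpow:
  assumes "one_input_network G"
  shows "v \<in> ring_cells G \<longleftrightarrow> (\<exists>k>0. (input_cell G ^^ k) v = v)"
proof -
  have "(u, v) \<in> arcs_ends G ^^ k \<longleftrightarrow> (input_cell G ^^ k) v = u" for u k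
  proof (induction k arbitrary: v)
    case (Suc k)
    then show ?case
      by (auto simp: relcomp_unfold arcs_ends_input_cell[OF assms] funpow_swap1)
  qed auto
  then show ?thesis by (auto simp: ring_cells_def trancl_power)
qed

lemma leaf_cell_iff:
  assumes "one_input_network G"
  shows "leaf_cell G v \<longleftrightarrow> v \<notin> range (input_cell G)"
proof -
  interpret fin_digraph G using assms by (simp add: one_input_network_def)
  have "leaf_cell G v \<longleftrightarrow> out_arcs G v = {}"
    using assms finite_out_arcs[of v] by (simp add: leaf_cell_def one_input_network_def out_degree_def)
  also have "\<dots> \<longleftrightarrow> (\<forall>w. (v, w) \<notin> arcs_ends G)"
    by (auto simp: arcs_ends_conv image_iff set_eq_iff)
  also have "\<dots> \<longleftrightarrow> v \<notin> range (input_cell G)"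
    by (auto simp: arcs_ends_input_cell[OF assms])
  finally show ?thesis .
qed

lemma synchrony_subspaces_eq_balanced:
  assumes G: "one_input_network G"
  shows "synchrony_subspaces G = balanced_subspaces (input_cell G)"
proof (intro equalityI subsetI)
  fix W assume W: "W \<in> synchrony_subspaces G"
  have "smooth (snd :: real \<times> real \<Rightarrow> real)"
    by (rule smooth_bounded_linear) (rule bounded_linear_snd)
  moreover have "pull (input_cell G) = (\<lambda>x. \<chi> v. snd (x $ v, x $ input_cell G v))"
    by (simp add: pull_def fun_eq_iff)
  ultimately have "admissible G (pull (input_cell G))" unfolding admissible_def by blast
  then have "flow_invariant (pull (input_cell G)) W" using W by (simp add: synchrony_subspaces_def)
  then show "W \<in> balanced_subspaces (input_cell G)"
    using W balanced_if_flow_invariant by (auto simp: balanced_subspaces_def synchrony_subspaces_def)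
next
  fix W assume W: "W \<in> balanced_subspaces (input_cell G)"
  then have "flow_invariant F W" if "admissible G F" for F
    using flow_invariant_if_balanced[OF W] that unfolding admissible_def by blast
  then show "W \<in> synchrony_subspaces G"
    using W by (simp add: synchrony_subspaces_def balanced_subspaces_def)
qed

text \<open>
  The path from the first ring cell above \<open>v\<close> down to \<open>v\<close> is extended by the arc into \<open>v\<close>. It stays
  a path because \<open>v\<close> is not on the ring and hence is never revisited by the iterates of \<open>p\<close>.
\<close>

lemma apath_from_ring:
  assumes G: "one_input_network G"
  shows "\<lbrakk>(input_cell G ^^ k) v \<in> ring_cells G; \<forall>j<k. (input_cell G ^^ j) v \<notin> ring_cells G\<rbrakk> \<Longrightarrow>
    \<exists>P. pre_digraph.apath G ((input_cell G ^^ k) v) P v \<and>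
      set (pre_digraph.awalk_verts G ((input_cell G ^^ k) v) P) = (\<lambda>j. (input_cell G ^^ j) v) ` {..k}"
proof (induction k arbitrary: v)
  case 0
  interpret fin_digraph G using G by (simp add: one_input_network_def)
  show ?case
    using G by (intro exI[of _ "[]"]) (simp add: apath_Nil_iff one_input_network_def)
next
  case (Suc k)
  interpret fin_digraph G using G by (simp add: one_input_network_def)
  let ?p = "input_cell G"
  let ?r = "(?p ^^ k) (?p v)"
  have ring: "?r \<in> ring_cells G" "\<forall>j<k. (?p ^^ j) (?p v) \<notin> ring_cells G"
    using Suc.prems(1) Suc.prems(2)[rule_format, of "Suc _"] by (simp_all add: funpow_swap1)
  obtain P where P: "apath ?r P (?p v)"
    "set (awalk_verts ?r P) = (\<lambda>j. (?p ^^ j) (?p v)) ` {..k}"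
    using Suc.IH[OF ring] by blast
  obtain e where e: "in_arcs G v = {e}" "tail G e = ?p v"
    using in_arcs_input_cell[OF G] by metis
  then have e': "e \<in> arcs G" "head G e = v" by (auto simp: set_eq_iff)
  have "v \<notin> ring_cells G" using Suc.prems(2)[rule_format, of 0] by simp
  then have fresh: "(?p ^^ Suc j) v \<noteq> v" for j using ring_cells_funpow[OF G, of v] by blast
  have last: "awlast ?r P = ?p v" using P(1) by (auto simp: apath_def)
  have "apath (?p v) [e] v"
    using e e' fresh[of 0] G by (simp add: apath_Cons_iff apath_Nil_iff one_input_network_def)
  moreover have "set (awalk_verts ?r P) \<inter> {v} = {}"
    unfolding P(2) using fresh[symmetric] by (auto simp: funpow_swap1)
  ultimately have path: "apath ?r (P @ [e]) v"
    unfolding apath_append_iff last using P(1) e' by simp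
  have "set (awalk_verts ?r (P @ [e])) = insert v (set (awalk_verts ?r P))"
    using path unfolding apath_def
    by (subst awalk_verts_append) (auto simp: last e' e)
  also have "\<dots> = (\<lambda>j. (?p ^^ j) v) ` {..Suc k}"
    unfolding P(2) atMost_Suc_eq_insert_0 by (simp add: image_image funpow_swap1)
  finally show ?case using path by (intro exI[of _ "P @ [e]"]) (simp add: funpow_swap1)
qed

text \<open>
  Following the inputs from a leaf until the ring is first met gives a tail with this leaf, so the end points of
  the tails are exactly the cells that are not inputs of any cell.
\<close>

lemma tail_leaves:
  assumes G: "one_input_network G" and reach: "\<And>v. \<exists>k. (input_cell G ^^ k) v \<in> ring_cells G"
  shows "tail_leaf G ` network_tails G = - range (input_cell G)"
proof (intro equalityI subsetI)
  interpret fin_digraph G using G by (simp add: one_input_network_def)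
  have not_ring: "v \<notin> ring_cells G" if "v \<notin> range (input_cell G)" for v
  proof
    assume "v \<in> ring_cells G"
    then obtain k where "k > 0" "(input_cell G ^^ k) v = v" using ring_cells_funpow[OF G] by blast
    then have "v = input_cell G ((input_cell G ^^ (k - 1)) v)" by (cases k) auto
    then show False using that by blast
  qed
  have leaf: "tail_leaf G P = v"
    if "apath r P v" "r \<in> ring_cells G" "v \<notin> range (input_cell G)" for r P v
  proof -
    have "P \<noteq> []" using that not_ring by (auto simp: apath_Nil_iff)
    moreover have "awlast r P = v" using that by (auto simp: apath_def)
    ultimately show ?thesis by (simp add: awalk_verts_conv tail_leaf_def)
  qed
  {
    fix v assume "v \<in> tail_leaf G ` network_tails G"
    then show "v \<in> - range (input_cell G)"
      using leaf leaf_cell_iff[OF G] unfolding network_tails_def by auto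
  }
  fix v assume "v \<in> - range (input_cell G)"
  then have v: "v \<notin> range (input_cell G)" by simp
  define k where "k = (LEAST k. (input_cell G ^^ k) v \<in> ring_cells G)"
  have k: "(input_cell G ^^ k) v \<in> ring_cells G" unfolding k_def using reach by (rule LeastI_ex)
  have less: "\<forall>j<k. (input_cell G ^^ j) v \<notin> ring_cells G" unfolding k_def using not_less_Least by blast
  let ?r = "(input_cell G ^^ k) v"
  obtain P where P: "apath ?r P v"
    "set (awalk_verts ?r P) = (\<lambda>j. (input_cell G ^^ j) v) ` {..k}"
    using apath_from_ring[OF G k less] by blast
  have "set (awalk_verts ?r P) \<inter> ring_cells G = {?r}"
    unfolding P(2) using k less by (auto simp: order_le_less)
  then have "P \<in> network_tails G"
    unfolding network_tails_def using k P(1) v leaf_cell_iff[OF G] by blast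
  moreover have "v = tail_leaf G P" using leaf[OF P(1) k v] by simp
  ultimately show "v \<in> tail_leaf G ` network_tails G" by blast
qed

lemma funpow_orbit_period:
  assumes x: "x \<in> orbit f x"
  shows "(f ^^ card (orbit f x)) x = x" and "(f ^^ k) x = x \<Longrightarrow> card (orbit f x) dvd k"
proof -
  let ?d = "funpow_dist1 f x x"
  have inj: "inj_on (\<lambda>n. (f ^^ n) x) {0..<?d}" by (rule inj_on_funpow_dist1[OF x])
  have card: "card (orbit f x) = ?d"
    using card_image[OF inj] orbit_conv_funpow_dist1[OF x] by simp
  have d: "(f ^^ ?d) x = x" by (rule funpow_dist1_prop[OF x])
  then show "(f ^^ card (orbit f x)) x = x" by (simp only: card)
  assume "(f ^^ k) x = x"
  then have "(f ^^ (k mod ?d)) x = (f ^^ 0) x" using funpow_mod_eq[OF d, of k] by simp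
  then have "k mod ?d = 0" using inj_onD[OF inj, of "k mod ?d" 0] by simp
  then show "card (orbit f x) dvd k" unfolding card by (rule dvd_eq_mod_eq_0[THEN iffD2])
qed

text \<open>
  The orbits of the input function are eventually periodic since there are finitely many cells. Each
  of them therefore enters the ring, which consists of a single cycle because \<open>\<sigma>\<close> is cyclic.
\<close>

lemma cycle_with_trees_ring:
  assumes G: "one_input_network G" and "m > 0" and inj: "inj_on c {1..m}"
    and ring: "ring_cells G = c ` {1..m}"
    and \<sigma>: "cyclic_on \<sigma> {1..m}" "\<And>i. i \<in> {1..m} \<Longrightarrow> input_cell G (c i) = c (\<sigma> i)"
  shows "cycle_with_trees (input_cell G) (c 1) m"
proof -
  let ?p = "input_cell G"
  have one: "1 \<in> {1..m}" using \<open>m > 0\<close> by simp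
  have orbit_\<sigma>: "orbit \<sigma> 1 = {1..m}" by (rule orbit_cyclic_eq3[OF \<sigma>(1) one])
  have power: "(?p ^^ k) (c 1) = c ((\<sigma> ^^ k) 1) \<and> (\<sigma> ^^ k) 1 \<in> {1..m}" for k
  proof (induction k)
    case (Suc k)
    have "\<sigma> ((\<sigma> ^^ k) 1) \<in> orbit \<sigma> 1" using Suc orbit_\<sigma> by (metis orbit.step)
    then show ?case using Suc \<sigma>(2) orbit_\<sigma> by simp
  qed (use one in simp)
  have orbit: "orbit ?p (c 1) = ring_cells G"
    unfolding ring orbit_\<sigma>[symmetric] orbit_altdef using power by auto
  have self: "c 1 \<in> orbit ?p (c 1)" unfolding orbit ring using one by blast
  have card: "card (orbit ?p (c 1)) = m" unfolding orbit ring using inj by (simp add: card_image)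
  show ?thesis
  proof
    show "(?p ^^ m) (c 1) = c 1" "(?p ^^ k) (c 1) = c 1 \<Longrightarrow> m dvd k" for k
      using funpow_orbit_period[OF self] unfolding card by auto
    fix v
    have "\<not> inj (\<lambda>k. (?p ^^ k) v)" using finite_imageD[of "\<lambda>k. (?p ^^ k) v" UNIV] by auto
    then obtain i j where "i < j" and eq: "(?p ^^ i) v = (?p ^^ j) v"
      unfolding inj_def by (metis nat_neq_iff)
    have "(?p ^^ (j - i)) ((?p ^^ i) v) = (?p ^^ j) v"
      using \<open>i < j\<close> by (simp add: funpow_funpow)
    then have "(?p ^^ (j - i)) ((?p ^^ i) v) = (?p ^^ i) v" by (simp only: eq)
    then have "(?p ^^ i) v \<in> orbit ?p (c 1)"
      using ring_cells_funpow[OF G] \<open>i < j\<close> unfolding orbit by (metis zero_less_diff)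
    then have "c 1 \<in> orbit ?p ((?p ^^ i) v)" by (rule orbit_swap[OF self])
    then obtain l where "c 1 = (?p ^^ l) ((?p ^^ i) v)" unfolding orbit_altdef by blast
    then show "\<exists>k. (?p ^^ k) v = c 1" by (metis funpow_funpow)
  qed (rule \<open>m > 0\<close>)
qed

section \<open>The five families\<close>

lemma periodic_space_1:
  fixes p :: "'n::finite \<Rightarrow> 'n"
  assumes "\<And>v. \<exists>k. (p ^^ k) v = r"
  shows "periodic_space p 1 = span {1}"
proof (intro equalityI subsetI)
  fix x assume "x \<in> periodic_space p 1"
  then have "x $ (p ^^ (1 * k)) v = x $ v" for k v by (rule periodic_space_mult)
  then have "x $ v = x $ r" for v using assms[of v] by (metis mult_1)
  then have "x = (x $ r) *\<^sub>R 1" by (simp add: vec_eq_iff)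
  then show "x \<in> span {1}" by (metis span_base span_scale singletonI)
next
  fix x :: "real ^ 'n" assume "x \<in> span {1}"
  then obtain a where "x = a *\<^sub>R 1" by (auto simp: span_singleton)
  then show "x \<in> periodic_space p 1" by (simp add: periodic_space_def)
qed

lemma span_insert_eq_plus: "span (insert a T) = span {a} + span T"
  using span_Un[of "{a}" T] by (auto simp: set_plus_def)

text \<open>
  A set whose indicator is killed by \<open>pull p\<close> contains no inputs. All inputs thus lie in the complement,
  and the partition into the set and its complement is compatible with \<open>p\<close>.
\<close>

lemma leaf_indicator_balanced:
  fixes S :: "'n::finite set"
  assumes "pull p (indicator_vec S) = 0" and "S \<noteq> {}"
  shows "span {1, indicator_vec S} \<in> balanced_subspaces p"
proof -
  have "p -` S = {}" using assms(1) by (simp add: pull_indicator_vec)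
  then have S: "p v \<notin> S" for v by blast
  obtain a where a: "a \<in> S" using assms(2) by blast
  have "span {1, indicator_vec S} = level_space (\<lambda>v. v \<in> S)"
  proof (intro equalityI subsetI)
    fix x assume x: "x \<in> level_space (\<lambda>v. v \<in> S)"
    have "x = (x $ p a) *\<^sub>R 1 + (x $ a - x $ p a) *\<^sub>R indicator_vec S"
    proof (subst vec_eq_iff, rule allI)
      fix v
      show "x $ v = ((x $ p a) *\<^sub>R 1 + (x $ a - x $ p a) *\<^sub>R indicator_vec S) $ v"
        using level_spaceD[OF x, of v a] level_spaceD[OF x, of v "p a"] a S[of a] by (cases "v \<in> S") auto
    qed
    also have "\<dots> \<in> span {1, indicator_vec S}"
      by (intro span_add span_scale span_base) auto
    finally show "x \<in> span {1, indicator_vec S}" .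
  next
    have "{1, indicator_vec S} \<subseteq> level_space (\<lambda>v. v \<in> S)" by (simp add: level_space_def)
    then have "span {1, indicator_vec S} \<subseteq> level_space (\<lambda>v. v \<in> S)"
      by (intro span_minimal polydiagonal_subspace polydiagonal_level_space)
    then show "x \<in> level_space (\<lambda>v. v \<in> S)" if "x \<in> span {1, indicator_vec S}" for x
      using that by blast
  qed
  moreover have "pull p x \<in> level_space (\<lambda>v. v \<in> S)" if x: "x \<in> level_space (\<lambda>v. v \<in> S)" for x
  proof -
    have "x $ p u = x $ p v" for u v using level_spaceD[OF x, of "p u" "p v"] S by simp
    then show ?thesis unfolding level_space_def by simp
  qed
  ultimately show ?thesis
    using polydiagonal_level_space[of "\<lambda>v. v \<in> S"] by (simp add: balanced_subspaces_def)
qed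

lemma zero_jordan_chain_krylov:
  assumes A: "\<And>x. A *v x = pull p x" and us: "zero_jordan_chain A us"
  obtains k where "length us = Suc k" "k \<ge> 1" "set us = krylov (pull p) k (us ! 0)"
    "(pull p ^^ k) (us ! 0) \<noteq> 0" "(pull p ^^ Suc k) (us ! 0) = 0"
proof -
  obtain k where k: "length us = Suc k" "k \<ge> 1"
    using us by (cases "length us") (auto simp: zero_jordan_chain_def)
  have nth: "us ! j = (pull p ^^ j) (us ! 0)" if "j < length us" for j
    using that
  proof (induction j)
    case (Suc j)
    have "us ! Suc j = A *v (us ! j)" using us Suc.prems by (simp add: zero_jordan_chain_def)
    also have "us ! j = (pull p ^^ j) (us ! 0)" using Suc by simp
    finally show ?case by (simp add: A)
  qed simp
  have "set us = (\<lambda>j. us ! j) ` {..k}"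
    using k by (auto simp: set_conv_nth less_Suc_eq_le)
  also have "\<dots> = krylov (pull p) k (us ! 0)"
    unfolding krylov_def using k by (intro image_cong) (auto intro: nth)
  finally have "set us = krylov (pull p) k (us ! 0)" .
  moreover have "last us = (pull p ^^ k) (us ! 0)"
    using k nth[of k] by (subst last_conv_nth) auto
  ultimately show ?thesis using that k us by (auto simp: zero_jordan_chain_def A)
qed

lemma krylov_zero_jordan_chain:
  assumes A: "\<And>x. A *v x = pull p x" and "k \<ge> 1"
    and "(pull p ^^ k) u \<noteq> 0" "(pull p ^^ Suc k) u = 0"
  defines "us \<equiv> map (\<lambda>j. (pull p ^^ j) u) [0..<Suc k]"
  shows "zero_jordan_chain A us" "set us = krylov (pull p) k u"
proof -
  have "us ! j = (pull p ^^ j) u" if "j \<le> k" for j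
    using that by (simp add: us_def del: upt_Suc)
  moreover have "length us = Suc k" by (simp add: us_def)
  moreover from this have "last us = us ! k" by (subst last_conv_nth) auto
  ultimately show "zero_jordan_chain A us"
    using assms(2-4) by (simp add: zero_jordan_chain_def A)
  show "set us = krylov (pull p) k u"
    unfolding us_def krylov_def set_map set_upt by (simp add: atLeast0_lessThan_Suc_eq_insert_0 lessThan_Suc_atMost atLeast0LessThan del: upt_Suc)
qed

lemma sum_of_axes_iff: "sum_of_axes u \<longleftrightarrow> (\<exists>K. K \<noteq> {} \<and> u = indicator_vec K)"
  for u :: "real ^ 'n::finite"
  by (simp add: sum_of_axes_def indicator_vec_conv_sum)

lemma sum_axes_image: "\<Sum>((\<lambda>v. axis v 1) ` S) = (indicator_vec S :: real ^ 'n::finite)"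
proof -
  have "inj_on (\<lambda>v. axis v (1 :: real)) S" by (auto simp: inj_on_def axis_eq_axis)
  then show ?thesis by (simp add: sum.reindex indicator_vec_conv_sum)
qed

theorem theorem4p4:
  fixes G :: "('n::finite, 'e) pre_digraph"
    and A :: "real ^ 'n ^ 'n"
    and n m t :: nat
    and c leaf :: "nat \<Rightarrow> 'n"
    and \<sigma> :: "nat \<Rightarrow> nat"
  assumes network: "one_input_network G"
    and n: "n = card (verts G)"
    and m: "1 \<le> m" "m \<le> n"
    and cells: "bij_betw c {1..n} (verts G)"
    and ring: "ring_cells G = c ` {1..m}"
    and A: "A = adjacency_matrix G"
    and block_C: "\<sigma> permutes {1..m}" "cyclic_on \<sigma> {1..m}"
      "\<forall>i\<in>{1..m}. \<forall>j\<in>{1..m}. A $ c i $ c j = (if j = \<sigma> i then 1 else 0)"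
    and block_0: "\<forall>i\<in>{1..m}. \<forall>j\<in>{m+1..n}. A $ c i $ c j = 0"
    and block_L: "\<forall>i\<in>{m+1..n}. \<forall>j\<in>{m+1..n}. i < j \<longrightarrow> A $ c i $ c j = 0"
    and t: "t = card (network_tails G)"
    and leaves: "bij_betw leaf {1..t} (tail_leaf G ` network_tails G)"
  shows
    "({W. join_irreducible (synchrony_subspaces G) W} =
       {real_points (E_omega A m 0)}
     \<union> {real_points (\<Sum>k<m div d. E_omega A m (k * d)) | d. d dvd m \<and> d \<noteq> m \<and> d \<noteq> 1}
     \<union> {real_points (\<Sum>j<m. E_omega A m j)}
     \<union> {real_points (E_omega A m 0) + span {\<Sum>U} | l U.
          1 \<le> l \<and> l \<le> t \<and> U \<subseteq> (\<lambda>k. axis (leaf k) 1) ` {1..t} \<and> card U = l}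
     \<union> {real_points (E_omega A m 0) + span (set us) | us.
          zero_jordan_chain A us \<and> (\<forall>u\<in>set us. sum_of_axes u) \<and>
          real_points (E_omega A m 0) + span (set us) \<in> synchrony_subspaces G})
     \<and> (dim (real_points (E_omega A m 0)) = 1)
     \<and> (\<forall>d. d dvd m \<and> d \<noteq> m \<and> d \<noteq> 1 \<longrightarrow>
       dim (real_points (\<Sum>k<m div d. E_omega A m (k * d))) = m div d)
     \<and> (dim (real_points (\<Sum>j<m. E_omega A m j)) = m)
     \<and> (\<forall>l U. 1 \<le> l \<and> l \<le> t \<and> U \<subseteq> (\<lambda>k. axis (leaf k) 1) ` {1..t} \<and> card U = l \<longrightarrow>
       dim (real_points (E_omega A m 0) + span {\<Sum>U}) = 2)
     \<and> (\<forall>us. zero_jordan_chain A us \<and> (\<forall>u\<in>set us. sum_of_axes u) \<longrightarrow>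
       dim (real_points (E_omega A m 0) + span (set us)) = length us + 1)"
    (is "?J = ?i \<union> ?ii \<union> ?iii \<union> ?iv \<union> ?v \<and> _")
proof -
  define p where "p = input_cell G"
  have A_pull: "A *v x = pull p x" for x
    unfolding A p_def by (rule adjacency_matrix_mult[OF network])
  have V: "synchrony_subspaces G = balanced_subspaces p"
    unfolding p_def by (rule synchrony_subspaces_eq_balanced[OF network])
  have "inj_on c {1..m}"
    using bij_betw_imp_inj_on[OF cells] by (rule inj_on_subset) (use m in auto)
  moreover have "input_cell G (c i) = c (\<sigma> i)" if "i \<in> {1..m}" for i
  proof -
    have "\<sigma> i \<in> {1..m}" using that permutes_in_image[OF block_C(1)] by blast
    then have "A $ c i $ c (\<sigma> i) = 1" using block_C(3) that by simp
    then show ?thesis unfolding A adjacency_matrix_nth[OF network] by (simp split: if_splits)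
  qed
  ultimately interpret cycle_with_trees p "c 1" m
    unfolding p_def using network m ring block_C(2) by (intro cycle_with_trees_ring) auto
  have leaf_range: "leaf ` {1..t} = - range p"
  proof -
    have "c 1 \<in> ring_cells G" unfolding ring using m by simp
    then have "\<exists>k. (input_cell G ^^ k) v \<in> ring_cells G" for v
      using reaches[of v] unfolding p_def by metis
    then show ?thesis
      using tail_leaves[OF network] bij_betw_imp_surj_on[OF leaves] by (simp add: p_def)
  qed

  have quotient_dvd: "m div d dvd m" if "d dvd m" for d
    using that dvd_def by fastforce
  have ii: "real_points (\<Sum>k<m div d. E_omega A m (k * d)) = periodic_space p (m div d)"
    if "d dvd m" for d
  proof -
    have "m div d * d = m" using that by simp
    then have "d > 0" "m div d > 0" using m by (auto intro: Nat.gr0I)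
    then show ?thesis
      using real_points_sum_E_omega[of A p "m div d" d, OF A_pull] that by simp
  qed
  have iii: "real_points (\<Sum>j<m. E_omega A m j) = periodic_space p m"
    using ii[of 1] by simp
  have i: "real_points (E_omega A m 0) = periodic_space p 1"
  proof -
    have "{..<1::nat} = {0}" by auto
    then show ?thesis using ii[of m] m by simp
  qed
  have plus: "real_points (E_omega A m 0) + span T = span (insert 1 T)" for T
    unfolding i periodic_space_1[OF reaches] by (rule span_insert_eq_plus[symmetric])
  have leaf_set: "\<exists>S. S \<noteq> {} \<and> \<Sum>U = indicator_vec S \<and> pull p (indicator_vec S) = 0"
    if U: "1 \<le> l" "U \<subseteq> (\<lambda>k. axis (leaf k) 1) ` {1..t}" "card U = l" for l U
  proof -
    have "U \<subseteq> (\<lambda>v. axis v 1) ` (- range p)"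
      using U(2) unfolding leaf_range[symmetric] image_image .
    then obtain S where S: "S \<subseteq> - range p" "U = (\<lambda>v. axis v 1) ` S" by (rule subset_imageE)
    then have "p -` S = {}" by auto
    moreover have "S \<noteq> {}" using U S by auto
    ultimately show ?thesis using S sum_axes_image[of S] pull_indicator_vec[of p S] by auto
  qed

  have main: "?J = ?i \<union> ?ii \<union> ?iii \<union> ?iv \<union> ?v"
  proof (intro equalityI subsetI)
    fix W assume "W \<in> ?J"
    then have "join_irreducible (balanced_subspaces p) W" by (simp add: V)
    then consider s where "s dvd m" "W = periodic_space p s"
      | k S where "(pull p ^^ k) (indicator_vec S) \<noteq> 0" "(pull p ^^ Suc k) (indicator_vec S) = 0"
        "W = span (insert 1 (krylov (pull p) k (indicator_vec S)))" "W \<in> balanced_subspaces p"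
      unfolding join_irreducible_iff by blast
    then show "W \<in> ?i \<union> ?ii \<union> ?iii \<union> ?iv \<union> ?v"
    proof cases
      case 1
      show ?thesis
      proof (cases "s = 1 \<or> s = m")
        case True
        then show ?thesis using 1 i iii by auto
      next
        case False
        define d where "d = m div s"
        have "s > 0" using 1(1) m by (auto intro: dvd_pos_nat)
        have md: "m = s * d" using 1(1) by (simp add: d_def)
        then have "d > 0" "m div d = s" using m by auto
        then have "d dvd m \<and> d \<noteq> m \<and> d \<noteq> 1" using False md by auto
        moreover from this have "W = real_points (\<Sum>k<m div d. E_omega A m (k * d))"
          using ii[of d] 1 \<open>m div d = s\<close> by simp
        ultimately show ?thesis by blast
      qed
    next
      case 2
      show ?thesis
      proof (cases "k = 0")
        case True
        have "S \<noteq> {}" "p -` S = {}" using 2 True by (auto simp: pull_indicator_vec)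
        then have S: "S \<subseteq> leaf ` {1..t}" unfolding leaf_range by auto
        define U where "U = (\<lambda>v. axis v (1 :: real)) ` S"
        have U: "U \<subseteq> (\<lambda>k. axis (leaf k) 1) ` {1..t}" using S unfolding U_def by auto
        have "card U \<le> card ((\<lambda>k. axis (leaf k) (1 :: real)) ` {1..t})" using U by (rule card_mono[rotated]) simp
        also have "\<dots> \<le> t" using card_image_le[of "{1..t}"] by simp
        finally have "card U \<le> t" .
        moreover have "1 \<le> card U"
          using \<open>S \<noteq> {}\<close> by (simp add: U_def Suc_le_eq card_gt_0_iff)
        moreover have "W = real_points (E_omega A m 0) + span {\<Sum>U}"
          unfolding plus U_def sum_axes_image using 2 True by (simp add: krylov_0)
        ultimately show ?thesis using U by blast
      next
        case False
        define us where "us = map (\<lambda>j. (pull p ^^ j) (indicator_vec S)) [0..<Suc k]"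
        have us: "zero_jordan_chain A us" "set us = krylov (pull p) k (indicator_vec S)"
          unfolding us_def using krylov_zero_jordan_chain[OF A_pull _ 2(1,2)] False by auto
        have "sum_of_axes u" if "u \<in> set us" for u
        proof -
          obtain j where j: "j \<le> k" "u = (pull p ^^ j) (indicator_vec S)"
            using \<open>u \<in> set us\<close> us(2) by (auto simp: krylov_def)
          have "(pull p ^^ k) (indicator_vec S) = (pull p ^^ (k - j)) u"
            using j by (simp add: funpow_funpow)
          then have "u \<noteq> 0" using 2(1) linear_0[OF linear_funpow[OF linear_pull]] by metis
          moreover have u: "u = indicator_vec ((p ^^ j) -` S)" by (simp add: j vec_eq_iff)
          ultimately have "(p ^^ j) -` S \<noteq> {}" by (simp only: indicator_vec_eq_0_iff not_False_eq_True)
          then show ?thesis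
            unfolding sum_of_axes_iff by (intro exI[of _ "(p ^^ j) -` S"] conjI u)
        qed
        moreover have "W = real_points (E_omega A m 0) + span (set us)"
          unfolding plus us by (rule 2)
        ultimately have "W \<in> ?v" using us(1) 2(4) unfolding V by blast
        then show ?thesis by blast
      qed
    qed
  next
    fix W assume "W \<in> ?i \<union> ?ii \<union> ?iii \<union> ?iv \<union> ?v"
    then consider "W \<in> ?i" | "W \<in> ?ii" | "W \<in> ?iii" | "W \<in> ?iv" | "W \<in> ?v" by blast
    then have "join_irreducible (balanced_subspaces p) W"
    proof cases
      case 1
      then show ?thesis using join_irreducible_periodic_space[of 1] i by simp
    next
      case 2
      then obtain d where d: "d dvd m" "W = periodic_space p (m div d)" using ii by auto
      then show ?thesis using join_irreducible_periodic_space[OF quotient_dvd[OF d(1)]] by simp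
    next
      case 3
      then show ?thesis using join_irreducible_periodic_space[of m] iii by simp
    next
      case 4
      then obtain U where U: "1 \<le> card U" "U \<subseteq> (\<lambda>k. axis (leaf k) 1) ` {1..t}"
        "W = real_points (E_omega A m 0) + span {\<Sum>U}" by blast
      obtain S where S: "S \<noteq> {}" "\<Sum>U = indicator_vec S" "pull p (indicator_vec S) = 0"
        using leaf_set[OF U(1,2) refl] by blast
      have "W = span {1, indicator_vec S}" unfolding U(3) plus S(2) by simp
      then show ?thesis
        using join_irreducible_krylov[of 0 p "indicator_vec S"] leaf_indicator_balanced[OF S(3,1)] S
        by (simp add: krylov_0)
    next
      case 5
      then obtain us where us: "zero_jordan_chain A us" "W = span (insert 1 (set us))"
        "W \<in> balanced_subspaces p" unfolding plus V by blast
      obtain k where k: "set us = krylov (pull p) k (us ! 0)"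
        "(pull p ^^ k) (us ! 0) \<noteq> 0" "(pull p ^^ Suc k) (us ! 0) = 0"
        using zero_jordan_chain_krylov[OF A_pull us(1)] by metis
      show ?thesis using join_irreducible_krylov[OF k(2,3)] us(2,3) unfolding k(1) by simp
    qed
    then show "W \<in> ?J" by (simp add: V)
  qed
  have dim_i: "dim (real_points (E_omega A m 0)) = 1"
    unfolding i by (rule dim_periodic_space) simp
  have dim_ii: "dim (real_points (\<Sum>k<m div d. E_omega A m (k * d))) = m div d" if "d dvd m" for d
    unfolding ii[OF that] by (rule dim_periodic_space[OF quotient_dvd[OF that]])
  have dim_iii: "dim (real_points (\<Sum>j<m. E_omega A m j)) = m"
    unfolding iii by (rule dim_periodic_space) simp
  have dim_iv: "dim (real_points (E_omega A m 0) + span {\<Sum>U}) = 2"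
    if U: "1 \<le> l" "U \<subseteq> (\<lambda>k. axis (leaf k) 1) ` {1..t}" "card U = l" for l U
  proof -
    obtain S where S: "S \<noteq> {}" "\<Sum>U = indicator_vec S" "pull p (indicator_vec S) = 0"
      using leaf_set[OF U] by blast
    then show ?thesis
      unfolding plus using dim_krylov[OF linear_pull[of p] pull_one, of 0 "indicator_vec S"]
      by (simp add: krylov_0)
  qed
  have dim_v: "dim (real_points (E_omega A m 0) + span (set us)) = length us + 1"
    if us: "zero_jordan_chain A us" for us
  proof -
    obtain k where k: "length us = Suc k" "set us = krylov (pull p) k (us ! 0)"
      "(pull p ^^ k) (us ! 0) \<noteq> 0" "(pull p ^^ Suc k) (us ! 0) = 0"
      using zero_jordan_chain_krylov[OF A_pull us] by metis
    show ?thesis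
      unfolding plus dim_span k(2) using dim_krylov[OF linear_pull pull_one _ k(3,4)] k(1) by simp
  qed
  show ?thesis
  proof (intro conjI main dim_i dim_iii)
    show "\<forall>d. d dvd m \<and> d \<noteq> m \<and> d \<noteq> 1 \<longrightarrow>
        dim (real_points (\<Sum>k<m div d. E_omega A m (k * d))) = m div d"
      using dim_ii by blast
    show "\<forall>l U. 1 \<le> l \<and> l \<le> t \<and> U \<subseteq> (\<lambda>k. axis (leaf k) 1) ` {1..t} \<and> card U = l \<longrightarrow>
        dim (real_points (E_omega A m 0) + span {\<Sum>U}) = 2"
      using dim_iv by blast
    show "\<forall>us. zero_jordan_chain A us \<and> (\<forall>u\<in>set us. sum_of_axes u) \<longrightarrow>
        dim (real_points (E_omega A m 0) + span (set us)) = length us + 1"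
      using dim_v by blast
  qed
qed

end
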